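(* Let $\mathbb{K}$ be a field, let $n\geq 1$, let $A \in \mathrm{M}_n(\mathbb{K})$, let $\mathbb{L}$ be a field extension of $\mathbb{K}$ and let $\alpha,\beta$ be non-zero scalars in $\mathbb{K}$. Then $A$ is an $(\alpha,\beta)$-composite in $\mathrm{M}_n(\mathbb{K})$ if and only if it is an $(\alpha,\beta)$-composite in $\mathrm{M}_n(\mathbb{L})$.
   Context: An element $x$ of an algebra $\mathcal{A}$ over a field containing the non-zero scalars $\alpha,\beta$ is an $(\alpha,\beta)$-composite in $\mathcal{A}$ if there are idempotents $p,q \in \mathcal{A}$ (i.e. $p^2=p$, $q^2=q$) with $x = \alpha p + \beta q$. *)

theory Defs
  imports "Jordan_Normal_Form.Matrix"
begin

(* The algebra is given as a HOL-Algebra module record, which carries both the ring operations and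
   the scalar multiplication; the locale HOL-Algebra.algebra is not required because it
   demands a commutative multiplication. *)
definition composite ::
  "('s::field, 'm, 'c) module_scheme \<Rightarrow> 's \<Rightarrow> 's \<Rightarrow> 'm \<Rightarrow> bool" where
  "composite M \<alpha> \<beta> x \<longleftrightarrow> x \<in> carrier M \<and>
     (\<exists>p \<in> carrier M. \<exists>q \<in> carrier M.
        p \<otimes>\<^bsub>M\<^esub> p = p \<and> q \<otimes>\<^bsub>M\<^esub> q = q \<and>
        x = \<alpha> \<odot>\<^bsub>M\<^esub> p \<oplus>\<^bsub>M\<^esub> \<beta> \<odot>\<^bsub>M\<^esub> q)"

end

theory Submission
  imports Defs "HOL-Computational_Algebra.Polynomial_Factorial" "HOL-Library.Function_Algebras"
begin

text \<open>Write \<open>s = \<alpha> + \<beta>\<close> and let \<open>A = \<alpha> p + \<beta> q\<close> with idempotents \<open>p\<close>, \<open>q\<close>. Since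
\<open>A\<^sup>2 - s A = - \<alpha> \<beta> (p - q)\<^sup>2\<close> and \<open>(p - q)\<^sup>2\<close> commutes with \<open>p\<close> and \<open>q\<close>, both idempotents commute
with the value of \<open>t = x\<^sup>2 - s x\<close> at \<open>A\<close>. The special values are the roots of
\<open>\<tau> = t (t + \<alpha> \<beta>) = x (x - s) (x - \<alpha>) (x - \<beta>)\<close>, because
\<open>\<tau>(A) = \<alpha>\<^sup>2 \<beta>\<^sup>2 [q, p]\<^sup>2\<close>. The commutator \<open>g = [q, p]\<close> satisfies \<open>g A = (s - A) g\<close>, so it
compares \<open>A\<close> with \<open>s - A\<close>. Three consequences are drawn from a pair \<open>(p, q)\<close>.

(Homotopy.) The equation \<open>A F + F A - s F = \<tau>(A)\<close> is solvable, by a multiple of \<open>p q (1 - p)\<close>.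

(Balance.) For \<open>f\<close> coprime to \<open>\<tau>\<close> the kernels of \<open>f(A)\<close> and \<open>f(s - A)\<close> have the same dimension,
because \<open>g\<close> is injective on them.

(Intertwining.) If \<open>a\<close> is a root of \<open>\<tau>\<close> and \<open>b = s - a \<noteq> a\<close>, the number of Jordan blocks of size
at least \<open>k + 2\<close> for \<open>a\<close> is at most the number of those of size at least \<open>k + 1\<close> for \<open>b\<close>.

The first condition is a linear system and the other two speak of dimensions of kernels of
polynomials in \<open>A\<close>, so all three descend from an extension field to the base field: a linear
system is carried down by a \<open>K\<close>-linear functional \<open>L \<rightarrow> K\<close>, and kernel dimensions do not change.

It remains to see that the three conditions suffice over any field
(lemma \<open>composite_on_if_invariants\<close>). Take a vector \<open>v\<close> whose annihilator \<open>m\<close> in \<open>K[x]\<close> is the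
minimal polynomial. The cyclic space \<open>K[x] v\<close> has an invariant complement (\<open>cyclic_projection\<close>).
Intertwining bounds the difference of the multiplicities of \<open>a\<close> and \<open>s - a\<close> in \<open>m\<close> by one. By balance, the
part \<open>n\<close> of \<open>m\<close> prime to \<open>\<tau>\<close> divides its image under \<open>x \<mapsto> s - x\<close>, and then the homotopy forces
\<open>n\<close> to be a polynomial in \<open>t\<close> (\<open>generic_factor_even\<close>); this step treats separable and inseparable
situations, in every characteristic, alike. Hence \<open>m = e h(t)\<close> with a divisor \<open>e\<close> of one of the products
\<open>(x - s)(x - \<alpha>)\<close>, \<open>(x - s)(x - \<beta>)\<close>, \<open>x (x - \<alpha>)\<close>, \<open>x (x - \<beta>)\<close>. For each product there is an explicit pair
of \<open>K[t]\<close>-linear idempotents of \<open>K[x]\<close> that represents multiplication by \<open>x\<close> as a composite and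
preserves the ideal generated by \<open>m\<close>, so the cyclic space is composite. The three conditions pass to the complement,
and induction on the dimension finishes the proof.\<close>

section \<open>Finite-dimensional subspaces\<close>

locale vspace = vector_space scale
  for scale :: "'k::field \<Rightarrow> 'v::ab_group_add \<Rightarrow> 'v" (infixr "*s" 75)
begin

abbreviation lin :: "('v \<Rightarrow> 'v) \<Rightarrow> bool" where
  "lin \<equiv> Vector_Spaces.linear scale scale"

lemma linI:
  assumes "\<And>x y. f (x + y) = f x + f y" "\<And>c x. f (scale c x) = scale c (f x)"
  shows "lin f"
  using assms by (simp add: Vector_Spaces.linear_iff vector_space_axioms)

lemma lin_add: "lin f \<Longrightarrow> f (x + y) = f x + f y"
  and lin_scale: "lin f \<Longrightarrow> f (scale c x) = scale c (f x)"
  by (simp_all add: Vector_Spaces.linear_iff)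

lemma lin_zero: "lin f \<Longrightarrow> f 0 = 0"
  using lin_scale[of f 0 0] by simp

lemma lin_diff: "lin f \<Longrightarrow> f (x - y) = f x - f y"
  using lin_add[of f "x - y" y] by simp

lemmas lin_simps = lin_add lin_scale lin_zero lin_diff

lemma lin_id: "lin (\<lambda>x. x)" by (rule linI) auto
lemma lin_comp: "lin f \<Longrightarrow> lin g \<Longrightarrow> lin (\<lambda>x. f (g x))"
  by (rule linI) (simp_all add: lin_simps)
lemma lin_plus: "lin f \<Longrightarrow> lin g \<Longrightarrow> lin (\<lambda>x. f x + g x)"
  by (rule linI) (simp_all add: lin_simps algebra_simps)
lemma lin_minus: "lin f \<Longrightarrow> lin g \<Longrightarrow> lin (\<lambda>x. f x - g x)"
  by (rule linI) (simp_all add: lin_simps algebra_simps)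
lemma lin_scaled: "lin f \<Longrightarrow> lin (\<lambda>x. scale c (f x))"
  by (rule linI) (simp_all add: lin_simps algebra_simps)

lemma subspace_kernel: "lin f \<Longrightarrow> subspace V \<Longrightarrow> subspace {v \<in> V. f v = 0}"
  unfolding subspace_def by (auto simp: lin_simps)

lemma subspace_image: "lin f \<Longrightarrow> subspace V \<Longrightarrow> subspace (f ` V)"
  unfolding subspace_def
  by (auto simp: lin_simps image_iff) (metis lin_zero, metis lin_add, metis lin_scale)

text \<open>The ambient type is allowed to be infinite-dimensional, so that one type can hold the spaces \<open>K\<^sup>n\<close>
for all \<open>n\<close>; dimension counts are made for subspaces with a finite spanning set.\<close>

definition findim :: "'v set \<Rightarrow> bool" where
  "findim V \<longleftrightarrow> subspace V \<and> (\<exists>B. finite B \<and> V \<subseteq> span B)"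

lemma findim_mono: "findim V \<Longrightarrow> subspace X \<Longrightarrow> X \<subseteq> V \<Longrightarrow> findim X"
  by (auto simp: findim_def)

lemma findim_independent:
  assumes "findim V" "independent B" "B \<subseteq> V"
  shows "finite B" "card B \<le> dim V"
proof -
  obtain C where C: "finite C" "V \<subseteq> span C" using assms by (auto simp: findim_def)
  show "finite B" using independent_span_bound[OF C(1) assms(2)] C assms by auto
  obtain D where D: "D \<subseteq> V" "independent D" "V \<subseteq> span D" "card D = dim V"
    using basis_exists by metis
  have fD: "finite D" using independent_span_bound[OF C(1) D(2)] C D by auto
  show "card B \<le> dim V" using independent_span_bound[OF fD assms(2)] D assms by auto
qed

lemma findim_basis_extend:
  assumes "findim V" "independent B" "B \<subseteq> V"
  obtains C where "B \<subseteq> C" "C \<subseteq> V" "independent C" "finite C" "span C = V" "card C = dim V"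
proof -
  obtain C where C: "B \<subseteq> C" "C \<subseteq> V" "independent C" "V \<subseteq> span C"
    using maximal_independent_subset_extend[OF assms(3,2)] by metis
  have "span C = V" using C span_minimal[OF C(2)] assms(1) by (auto simp: findim_def)
  then show ?thesis using that[of C] C findim_independent[OF assms(1) C(3,2)]
      basis_card_eq_dim[OF C(2,4,3)] by auto
qed

lemma dim_mono_findim:
  assumes "findim V" "subspace X" "X \<subseteq> V"
  shows "dim X \<le> dim V"
proof -
  obtain B where "B \<subseteq> X" "independent B" "card B = dim X"
    using findim_basis_extend[OF findim_mono[OF assms] independent_empty] by auto
  then show ?thesis using findim_independent(2)[of V B] assms by auto
qed

lemma dim_eq_findim:
  assumes "findim V" "subspace X" "X \<subseteq> V" "dim V \<le> dim X"
  shows "X = V"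
proof -
  obtain B where B: "B \<subseteq> X" "independent B" "card B = dim X" "span B = X"
    using findim_basis_extend[OF findim_mono[OF assms(1-3)] independent_empty] by auto
  obtain C where C: "B \<subseteq> C" "independent C" "finite C" "span C = V" "card C = dim V"
    using findim_basis_extend[OF assms(1) B(2)] B(1) assms(3) by (metis subset_trans)
  have "B = C" using C B assms(4) by (metis card_seteq)
  then show ?thesis using B C by simp
qed

lemma findim_image: "lin f \<Longrightarrow> findim V \<Longrightarrow> findim (f ` V)"
proof -
  assume f: "lin f" and V: "findim V"
  interpret vector_space_pair scale scale by unfold_locales
  obtain B where B: "finite B" "V \<subseteq> span B" using V by (auto simp: findim_def)
  have "f ` V \<subseteq> span (f ` B)" using B linear_span_image[OF f, of B] by auto
  then show ?thesis using B subspace_image[OF f] V by (auto simp: findim_def)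
qed

lemma rank_nullity:
  assumes f: "lin f" and V: "findim V"
  shows "dim V = dim {v \<in> V. f v = 0} + dim (f ` V)"
proof -
  interpret vector_space_pair scale scale by unfold_locales
  let ?K = "{v \<in> V. f v = 0}"
  have sV: "subspace V" using V by (simp add: findim_def)
  have K: "findim ?K" using findim_mono[OF V subspace_kernel[OF f sV]] by auto
  obtain B where B: "B \<subseteq> ?K" "independent B" "finite B" "span B = ?K" "card B = dim ?K"
    using findim_basis_extend[OF K independent_empty] by auto
  obtain C where C: "B \<subseteq> C" "C \<subseteq> V" "independent C" "finite C" "span C = V" "card C = dim V"
    using findim_basis_extend[OF V B(2)] B(1) by auto
  let ?D = "C - B"
  have inj0: "v = 0" if "v \<in> span ?D" "f v = 0" for v
  proof -
    have "v \<in> span C" using that span_mono[of ?D C] by auto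
    then have "v \<in> span B" using that C B by auto
    then obtain u where u: "v = (\<Sum>b\<in>B. u b *s b)" using B(3) by (auto simp: span_finite)
    from that(1) C(4) obtain w where w: "v = (\<Sum>b\<in>?D. w b *s b)" by (auto simp: span_finite)
    define h where "h b = (if b \<in> B then - u b else w b)" for b
    have "(\<Sum>b\<in>C. h b *s b) = (\<Sum>b\<in>?D. h b *s b) + (\<Sum>b\<in>B. h b *s b)"
      by (rule sum.subset_diff[OF C(1,4)])
    also have "\<dots> = v - v"
      by (subst (1) w, subst u) (simp add: h_def sum_negf)
    finally have "\<forall>b\<in>C. h b = 0" using C(3,4) by (auto simp: dependent_finite)
    then have "\<forall>b\<in>?D. w b = 0" by (auto simp: h_def)
    then show ?thesis by (simp add: w)
  qed
  have injD: "inj_on f (span ?D)"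
    by (rule inj_onI) (metis inj0 eq_iff_diff_eq_0 f lin_diff span_diff)
  have ind: "independent (f ` ?D)"
    using linear_independent_injective_image[OF f _ injD] independent_mono[OF C(3)] by auto
  have sp: "span (f ` ?D) = f ` V"
  proof
    show "span (f ` ?D) \<subseteq> f ` V"
      using span_minimal[of "f ` ?D" "f ` V"] subspace_image[OF f sV] C(2) by auto
    have "f ` C \<subseteq> span (f ` ?D)"
    proof
      fix y assume "y \<in> f ` C"
      then obtain c where "c \<in> C" "y = f c" by auto
      then show "y \<in> span (f ` ?D)" 
        by (cases "c \<in> B") (use B(1) span_zero in \<open>auto intro: span_base\<close>)
    qed
    then have "span (f ` C) \<subseteq> span (f ` ?D)" by (rule span_minimal) (rule subspace_span)
    then show "f ` V \<subseteq> span (f ` ?D)" using C(5) linear_span_image[OF f, of C] by auto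
  qed
  have "dim (f ` V) = card (f ` ?D)" using dim_span_eq_card_independent[OF ind] sp by simp
  also have "\<dots> = card ?D" using injD by (meson card_image inj_on_subset span_superset)
  finally show ?thesis using B C card_mono[OF C(4,1)] by (simp add: card_Diff_subset)
qed

end

section \<open>Polynomials over a field\<close>

text \<open>The greatest common divisor is obtained as a nonzero element of least degree in the ideal of \<open>f\<close> and \<open>g\<close>.\<close>

lemma poly_bezout:
  fixes f g :: "'k::field poly"
  assumes "f \<noteq> 0"
  obtains d u w where "d = u * f + w * g" "d dvd f" "d dvd g" "d \<noteq> 0"
proof -
  define I where "I d \<longleftrightarrow> d \<noteq> 0 \<and> (\<exists>u w. d = u * f + w * g)" for d
  have "f = 1 * f + 0 * g" by simp
  then have "I f" using assms unfolding I_def by blast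
  then obtain d where d: "I d" "\<And>e. I e \<Longrightarrow> degree d \<le> degree e"
    using ex_has_least_nat[of I f degree] by auto
  obtain u w where uw: "d = u * f + w * g" using d(1) by (auto simp: I_def)
  have dvd: "d dvd h" if "h = a * f + b * g" for h a b
  proof (rule ccontr)
    assume "\<not> d dvd h"
    then have ne: "h mod d \<noteq> 0" by (simp add: mod_eq_0_iff_dvd)
    have "h mod d = h - (h div d) * d" by (simp add: minus_div_mult_eq_mod)
    also have "\<dots> = (a - (h div d) * u) * f + (b - (h div d) * w) * g"
      by (subst (2) uw) (simp add: that algebra_simps)
    finally have "I (h mod d)" using ne by (auto simp: I_def)
    then have "degree d \<le> degree (h mod d)" by (rule d(2))
    moreover have "degree (h mod d) < degree d"
      using ne d(1) degree_mod_less[of d h] unfolding I_def by blast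
    ultimately show False by simp
  qed
  show ?thesis
    using that[OF uw] dvd[of f 1 0] dvd[of g 0 1] d(1) by (auto simp: I_def)
qed

lemma coprime_poly_bezout:
  fixes f g :: "'k::field poly"
  assumes "coprime f g"
  obtains u w where "u * f + w * g = 1"
proof (cases "f = 0")
  case True
  then have "g dvd 1" using assms by simp
  then obtain w where "1 = g * w" by (auto elim: dvdE)
  then show ?thesis using that[of 0 w] by (simp add: mult.commute)
next
  case False
  obtain d u w where d: "d = u * f + w * g" "d dvd f" "d dvd g"
    using poly_bezout[OF False] by metis
  have "d dvd 1" using coprime_common_divisor[OF assms d(2,3)] .
  then obtain e where "1 = d * e" by (auto elim: dvdE)
  then have "(e * u) * f + (e * w) * g = 1" by (simp add: d(1) algebra_simps)
  then show ?thesis by (rule that)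
qed

lemma coprime_polyI:
  fixes f g :: "'k::field poly"
  shows "u * f + w * g = 1 \<Longrightarrow> coprime f g"
proof (rule coprimeI)
  fix c assume *: "u * f + w * g = 1" and c: "c dvd f" "c dvd g"
  have "c dvd u * f + w * g" using c by (intro dvd_add dvd_mult)
  then show "c dvd 1" using * by simp
qed

lemma coprime_dvd_mult_poly:
  fixes f g h :: "'k::field poly"
  assumes "f dvd g * h" "coprime f g"
  shows "f dvd h"
proof -
  obtain u w where "u * f + w * g = 1" using coprime_poly_bezout[OF assms(2)] by metis
  then have "h = (u * f + w * g) * h" by simp
  also have "\<dots> = f * (u * h) + w * (g * h)" by (simp add: algebra_simps)
  finally have h: "h = f * (u * h) + w * (g * h)" .
  have "f dvd f * (u * h) + w * (g * h)" 
    by (rule dvd_add[OF dvd_triv_left dvd_mult[OF assms(1)]])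
  then show ?thesis using h by simp
qed

lemma coprime_mult_poly:
  fixes f g h :: "'k::field poly"
  assumes "coprime f h" "coprime g h"
  shows "coprime (f * g) h"
proof -
  obtain u w u' w' where bez: "u * f + w * h = 1" "u' * g + w' * h = 1"
    using coprime_poly_bezout[OF assms(1)] coprime_poly_bezout[OF assms(2)] by metis
  have "(u * f + w * h) * (u' * g + w' * h) = 1" using bez by simp
  then have "(u * u') * (f * g) + (u * f * w' + w * u' * g + w * w' * h) * h = 1"
    by (simp add: algebra_simps)
  then show ?thesis by (rule coprime_polyI)
qed

lemma coprime_power_poly:
  fixes f h :: "'k::field poly"
  assumes "coprime f h"
  shows "coprime (f ^ k) h"
  by (induction k) (simp_all add: coprime_mult_poly assms)

lemma prime_factor_poly:
  fixes f :: "'k::field poly"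
  assumes "f \<noteq> 0" "\<not> f dvd 1"
  obtains r where "prime_elem r" "r dvd f"
proof -
  define I where "I d \<longleftrightarrow> d dvd f \<and> \<not> d dvd 1" for d
  have "I f" using assms by (simp add: I_def)
  then obtain r where r: "I r" "\<And>e. I e \<Longrightarrow> degree r \<le> degree e"
    using ex_has_least_nat[of I f degree] by auto
  have r0: "r \<noteq> 0" using r(1) assms by (auto simp: I_def)
  have "irreducible r"
  proof (rule irreducibleI)
    show "r \<noteq> 0" by fact
    show "\<not> r dvd 1" using r(1) by (simp add: I_def)
    fix a b assume ab: "r = a * b"
    show "a dvd 1 \<or> b dvd 1"
    proof (rule ccontr)
      assume "\<not> (a dvd 1 \<or> b dvd 1)"
      then have "I a" and b: "\<not> b dvd 1" using r(1) ab by (auto simp: I_def dest: dvd_mult_left)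
      then have "degree r \<le> degree a" using r(2) by auto
      moreover have "degree r = degree a + degree b"
        using ab r0 by (auto simp: degree_mult_eq)
      moreover have "degree b \<noteq> 0" using b r0 ab by (auto simp: is_unit_iff_degree)
      ultimately show False by simp
    qed
  qed
  then show ?thesis using that[of r] r(1) field_poly_irreducible_imp_prime by (auto simp: I_def)
qed

lemma coprime_prime_poly:
  fixes r f :: "'k::field poly"
  assumes "prime_elem r" "\<not> r dvd f"
  shows "coprime r f"
proof (rule coprimeI)
  fix d assume d: "d dvd r" "d dvd f"
  then obtain e where e: "r = d * e" by (auto elim: dvdE)
  have "e dvd 1 \<or> d dvd 1"
    using prime_elem_imp_irreducible[OF assms(1)] e by (auto dest: irreducibleD)
  moreover have "\<not> e dvd 1"
  proof
    assume "e dvd 1"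
    then have "r dvd d" using e by simp
    then show False using d(2) assms(2) dvd_trans by blast
  qed
  ultimately show "d dvd 1" by blast
qed

lemma prime_power_split:
  fixes r d :: "'k::field poly"
  assumes "prime_elem r" "d \<noteq> 0"
  obtains i d0 where "d = r ^ i * d0" "\<not> r dvd d0"
  using assms(2)
proof (induction "degree d" arbitrary: d thesis rule: less_induct)
  case less
  show ?case
  proof (cases "r dvd d")
    case False
    then show ?thesis using less(2)[of 0 d] by simp
  next
    case True
    then obtain d' where d': "d = r * d'" by (auto elim: dvdE)
    have "degree r \<noteq> 0" "r \<noteq> 0" "d' \<noteq> 0"
      using assms(1) less(3) d' by (auto simp: prime_elem_def is_unit_iff_degree)
    then have "degree d' < degree d" by (simp add: d' degree_mult_eq)
    then obtain i d0 where "d' = r ^ i * d0" "\<not> r dvd d0"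
      using less(1)[of d'] \<open>d' \<noteq> 0\<close> by metis
    then show ?thesis using less(2)[of "Suc i" d0] d' by (simp add: mult.assoc)
  qed
qed

section \<open>The polynomial module of an endomorphism\<close>

locale endo = vspace scale
  for scale :: "'k::field \<Rightarrow> 'v::ab_group_add \<Rightarrow> 'v" (infixr "*s" 75) +
  fixes T :: "'v \<Rightarrow> 'v"
  assumes lin_T: "lin T"
begin

lemma T_0 [simp]: "T 0 = 0" by (rule lin_zero[OF lin_T])

text \<open>The operator \<open>T\<close> turns the space into a \<open>K[x]\<close>-module, in which \<open>f\<close> acts as \<open>f(T)\<close>; the
definition is the Horner scheme.\<close>

definition act :: "'k poly \<Rightarrow> 'v \<Rightarrow> 'v" where
  "act f v = fold_coeffs (\<lambda>a w. a *s v + T w) f 0"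

lemma act_0 [simp]: "act 0 v = 0" by (simp add: act_def)

lemma act_pCons [simp]: "act (pCons a f) v = a *s v + T (act f v)"
proof (cases "a = 0 \<and> f = 0")
  case True
  then show ?thesis using lin_zero[OF lin_T] by simp
next
  case False
  then show ?thesis
    by (cases "a = 0") (auto simp: act_def)
qed

lemma act_1 [simp]: "act 1 v = v"
  using lin_zero[OF lin_T] by (simp add: one_pCons)

lemma act_add: "act (f + g) v = act f v + act g v"
  by (induction f g rule: poly_induct2) (simp_all add: lin_simps[OF lin_T] algebra_simps)

lemma act_smult: "act (smult c f) v = c *s act f v"
  by (induction f) (simp_all add: lin_simps[OF lin_T] algebra_simps)

lemma act_diff: "act (f - g) v = act f v - act g v"
  using act_add[of "f - g" g v] by simp

lemma act_minus: "act (- f) v = - act f v"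
  using act_diff[of 0 f v] by simp

lemma act_mult: "act (f * g) v = act f (act g v)"
  by (induction f) (simp_all add: act_add act_smult)

lemma act_power: "act (f ^ Suc k) v = act f (act (f ^ k) v)"
  by (simp add: act_mult)

lemma act_sum: "act (\<Sum>i\<in>S. f i) v = (\<Sum>i\<in>S. act (f i) v)"
  by (induction S rule: infinite_finite_induct) (simp_all add: act_add)

lemma lin_act: "lin (act f)"
proof (induction f)
  case 0
  show ?case by (rule linI) simp_all
next
  case (pCons a f)
  show ?case
    by (rule linI) (simp_all add: lin_simps[OF pCons(2)] lin_simps[OF lin_T] algebra_simps)
qed

lemmas act_lin_simps = lin_simps[OF lin_act]

lemma act_comm: "act f (act g v) = act g (act f v)"
  by (metis act_mult mult.commute)

lemma act_T: "act f (T v) = T (act f v)"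
  using act_comm[of f "[:0, 1:]" v] lin_zero[OF lin_T] by simp

lemma act_linear [simp]: "act [:- a, 1:] v = T v - a *s v"
  using lin_zero[OF lin_T] by simp

lemma act_sum_monom: "act f v = (\<Sum>i\<le>degree f. coeff f i *s act (monom 1 i) v)"
proof -
  have "f = (\<Sum>i\<le>degree f. smult (coeff f i) (monom 1 i))"
    using poly_as_sum_of_monoms[of f] by (simp add: smult_monom)
  then have "act f v = act (\<Sum>i\<le>degree f. smult (coeff f i) (monom 1 i)) v" by simp
  then show ?thesis by (simp only: act_sum act_smult)
qed

definition invspace :: "'v set \<Rightarrow> bool" where
  "invspace V \<longleftrightarrow> findim V \<and> T ` V \<subseteq> V"

lemma invspaceD:
  assumes "invspace V"
  shows "findim V" "subspace V" "\<And>x. x \<in> V \<Longrightarrow> T x \<in> V"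
  using assms by (auto simp: invspace_def findim_def)

lemma act_in: "invspace V \<Longrightarrow> v \<in> V \<Longrightarrow> act f v \<in> V"
proof (induction f)
  case 0
  then show ?case using subspace_0[OF invspaceD(2)] by simp
next
  case (pCons a f)
  then show ?case
    using subspace_add[OF invspaceD(2)] subspace_scale[OF invspaceD(2)] invspaceD(3) by simp
qed

lemma act_commute:
  assumes V: "invspace V" and g: "lin g" and comm: "\<And>x. x \<in> V \<Longrightarrow> g (T x) = T (g x)"
    and v: "v \<in> V"
  shows "g (act f v) = act f (g v)"
proof (induction f)
  case 0
  show ?case using lin_zero[OF g] by simp
next
  case (pCons a f)
  then show ?case using comm[OF act_in[OF V v]] by (simp add: lin_add[OF g] lin_scale[OF g])
qed

text \<open>The annihilator ideal of \<open>v\<close> is generated by \<open>m\<close>; generators are only determined up to a unit.\<close>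

definition is_order :: "'k poly \<Rightarrow> 'v \<Rightarrow> bool" where
  "is_order m v \<longleftrightarrow> m \<noteq> 0 \<and> (\<forall>f. act f v = 0 \<longleftrightarrow> m dvd f)"

lemma annihilator_exists:
  assumes V: "invspace V" and v: "v \<in> V"
  obtains f where "f \<noteq> 0" "act f v = 0" "degree f \<le> dim V"
proof -
  define g where "g i = act (monom 1 i) v" for i
  let ?N = "dim V"
  show ?thesis
  proof (cases "inj_on g {..?N}")
    case False
    then obtain i j where ij: "i \<le> ?N" "j \<le> ?N" "i \<noteq> j" "g i = g j"
      by (auto simp: inj_on_def)
    let ?f = "monom 1 i - monom (1::'k) j"
    have "coeff ?f i = 1" using ij by simp
    then have "?f \<noteq> 0" by (metis coeff_0 zero_neq_one)
    moreover have "act ?f v = 0" using ij by (simp add: act_diff g_def)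
    moreover have "degree ?f \<le> ?N"
      using ij by (intro degree_diff_le) (auto simp: degree_monom_eq)
    ultimately show ?thesis by (rule that)
  next
    case True
    let ?S = "g ` {..?N}"
    have SV: "?S \<subseteq> V" using act_in[OF V v] by (auto simp: g_def)
    have "card ?S = Suc ?N" using True by (simp add: card_image)
    then have "dependent ?S"
      using findim_independent(2)[OF invspaceD(1)[OF V] _ SV] by fastforce
    then obtain u where u: "\<exists>b\<in>?S. u b \<noteq> 0" "(\<Sum>b\<in>?S. u b *s b) = 0"
      by (auto simp: dependent_finite)
    let ?f = "\<Sum>i\<le>?N. monom (u (g i)) i"
    have coeff: "coeff ?f i = (if i \<le> ?N then u (g i) else 0)" for i
      by (simp add: coeff_sum)
    have "?f \<noteq> 0"
    proof
      assume "?f = 0"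
      then have "u (g i) = 0" if "i \<le> ?N" for i using coeff[of i] that by simp
      then show False using u(1) by auto
    qed
    moreover have "act ?f v = (\<Sum>i\<le>?N. u (g i) *s g i)"
    proof -
      have "act (monom (u (g i)) i) v = u (g i) *s g i" for i
        using act_smult[of "u (g i)" "monom 1 i" v] by (simp add: smult_monom g_def)
      then show ?thesis by (simp add: act_sum)
    qed
    then have "act ?f v = 0" using u(2) True by (simp add: sum.reindex)
    moreover have "degree ?f \<le> ?N" by (rule degree_le) (simp add: coeff)
    ultimately show ?thesis by (rule that)
  qed
qed

lemma order_exists:
  assumes V: "invspace V" and v: "v \<in> V"
  obtains m where "is_order m v" "degree m \<le> dim V"
proof -
  define I where "I f \<longleftrightarrow> f \<noteq> 0 \<and> act f v = 0" for f
  obtain f where f: "I f" "degree f \<le> dim V"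
    using annihilator_exists[OF V v] by (metis I_def)
  obtain m where m: "I m" "\<And>e. I e \<Longrightarrow> degree m \<le> degree e"
    using ex_has_least_nat[of I f degree] f by auto
  have "m dvd h" if "act h v = 0" for h
  proof (rule ccontr)
    assume "\<not> m dvd h"
    then have ne: "h mod m \<noteq> 0" by (simp add: mod_eq_0_iff_dvd)
    have "h mod m = h - (h div m) * m" by (simp add: minus_div_mult_eq_mod)
    then have "act (h mod m) v = 0"
      using that m(1) by (simp add: act_diff act_mult I_def act_lin_simps)
    then have "degree m \<le> degree (h mod m)" using ne m(2) by (auto simp: I_def)
    moreover have "degree (h mod m) < degree m"
      using ne m(1) degree_mod_less[of m h] unfolding I_def by blast
    ultimately show False by simp
  qed
  moreover have "act h v = 0" if "m dvd h" for h
    using that m(1) by (auto simp: I_def act_mult act_comm[of m] act_lin_simps elim!: dvdE)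
  ultimately have "is_order m v" using m(1) by (auto simp: is_order_def I_def)
  then show ?thesis using that m(2)[OF f(1)] f(2) by auto
qed

lemma is_order_cofactor:
  assumes "is_order (a * b) v"
  shows "is_order b (act a v)"
  using assms by (auto simp: is_order_def act_mult[symmetric] mult.commute)

lemma is_order_add:
  assumes v: "is_order f v" and w: "is_order g w" and c: "coprime f g"
  shows "is_order (f * g) (v + w)"
  unfolding is_order_def
proof (intro conjI allI iffI)
  show "f * g \<noteq> 0" using v w by (auto simp: is_order_def)
  fix h
  show "act h (v + w) = 0" if "f * g dvd h"
  proof -
    have "f dvd h" "g dvd h" using that by (auto dest: dvd_mult_left dvd_mult_right)
    then have "act h v = 0" "act h w = 0" using v w by (auto simp: is_order_def)
    then show ?thesis by (simp add: act_lin_simps)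
  qed
  assume *: "act h (v + w) = 0"
  have "act (g * h) v = 0"
  proof -
    have "act (g * h) v = act (g * h) (v + w)"
      using w by (simp add: is_order_def act_lin_simps)
    also have "\<dots> = 0" by (simp only: act_mult * lin_zero[OF lin_act])
    finally show ?thesis .
  qed
  then have "f dvd g * h" using v by (simp add: is_order_def)
  then have "f dvd h" using c by (rule coprime_dvd_mult_poly)
  have "act (f * h) w = 0"
  proof -
    have "act (f * h) w = act (f * h) (v + w)"
      using v by (simp add: is_order_def act_lin_simps)
    also have "\<dots> = 0" by (simp only: act_mult * lin_zero[OF lin_act])
    finally show ?thesis .
  qed
  then have "g dvd f * h" using w by (simp add: is_order_def)
  then have "g dvd h" using coprime_dvd_mult_poly[of g f h] c by (simp add: coprime_commute)
  obtain k where k: "h = f * k" using \<open>f dvd h\<close> by (auto elim: dvdE)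
  then have "g dvd k" using \<open>g dvd h\<close> coprime_dvd_mult_poly[of g f k] c
    by (simp add: coprime_commute)
  then show "f * g dvd h" by (simp add: k mult_dvd_mono)
qed

text \<open>This is the step that produces the minimal polynomial as the order of a vector over any field,
finite ones included: if \<open>g\<close> does not divide \<open>f\<close>, some prime \<open>r\<close> occurs in \<open>g\<close> with an exponent
larger than in \<open>f\<close>. Multiples of \<open>v\<close> and \<open>w\<close> with orders "\<open>f\<close> without \<open>r\<close>" and a power of \<open>r\<close> have
coprime orders, and the order of their sum is the product.\<close>

lemma order_not_dvd_increase:
  assumes v: "is_order f v" and w: "is_order g w" and nd: "\<not> g dvd f"
  obtains a b h where "is_order h (act a v + act b w)" "degree h > degree f"
proof -
  have f0: "f \<noteq> 0" and g0: "g \<noteq> 0" using v w by (auto simp: is_order_def)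
  obtain d x y where d: "d = x * f + y * g" "d dvd f" "d dvd g" "d \<noteq> 0"
    using poly_bezout[OF f0] by metis
  obtain f' g' where fg: "f = d * f'" "g = d * g'" using d(2,3) by (auto elim!: dvdE)
  have "d * (x * f' + y * g') = d * 1" using d(1) fg by (simp add: algebra_simps)
  then have bez: "x * f' + y * g' = 1" using d(4) by simp
  have "\<not> g' dvd 1"
    using nd fg by (metis dvd_mult_unit_iff dvd_refl mult_dvd_mono unit_imp_dvd)
  moreover have "g' \<noteq> 0" using g0 fg by auto
  ultimately obtain r where r: "prime_elem r" "r dvd g'" using prime_factor_poly by metis
  have nr: "\<not> r dvd f'" using bez r by (metis coprime_polyI coprime_common_divisor prime_elem_not_unit)
  obtain i d0 where i: "d = r ^ i * d0" "\<not> r dvd d0"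
    using prime_power_split[OF r(1) d(4)] by metis
  obtain g0 where g0: "g' = r * g0" using r(2) by (auto elim: dvdE)
  have nrf: "\<not> r dvd d0 * f'" using r(1) i(2) nr by (simp add: prime_elem_dvd_mult_iff)
  have c: "coprime (d0 * f') (r ^ Suc i)"
    using coprime_power_poly[OF coprime_prime_poly[OF r(1) nrf], of "Suc i"] by (simp add: coprime_commute)
  have "is_order (d0 * f') (act (r ^ i) v)"
    using is_order_cofactor[of "r ^ i" "d0 * f'"] v fg i by (simp add: mult.assoc)
  moreover have "is_order (r ^ Suc i) (act (d0 * g0) w)"
    using is_order_cofactor[of "d0 * g0" "r ^ Suc i"] w fg i g0 by (simp add: algebra_simps)
  ultimately have "is_order (d0 * f' * r ^ Suc i) (act (r ^ i) v + act (d0 * g0) w)"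
    using c by (rule is_order_add)
  moreover have "degree (d0 * f' * r ^ Suc i) > degree f"
  proof -
    have eq: "d0 * f' * r ^ Suc i = r * f" by (simp add: fg i algebra_simps)
    moreover have "degree r \<noteq> 0" using r(1) by (metis is_unit_iff_degree prime_elem_def)
    moreover have "r \<noteq> 0" using r(1) by auto
    ultimately show ?thesis unfolding eq using f0 by (simp add: degree_mult_eq)
  qed
  ultimately show ?thesis by (rule that)
qed

lemma maximal_order_exists:
  assumes V: "invspace V"
  obtains m v where "v \<in> V" "is_order m v" "\<And>w. w \<in> V \<Longrightarrow> act m w = 0"
proof -
  define I where "I z \<longleftrightarrow> snd z \<in> V \<and> is_order (fst z) (snd z) \<and> degree (fst z) \<le> dim V" for z
  have sV: "subspace V" using V by (rule invspaceD)
  have "0 \<in> V" using subspace_0[OF sV] .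
  then obtain m0 where "is_order m0 0" "degree m0 \<le> dim V" using order_exists[OF V] by blast
  then have "I (m0, 0)" using \<open>0 \<in> V\<close> by (simp add: I_def)
  then have "\<exists>z. I z \<and> (\<forall>y. I y \<longrightarrow> degree (fst y) \<le> degree (fst z))"
    by (rule ex_has_greatest_nat[of I _ _ "Suc (dim V)"]) (simp add: I_def)
  then obtain z where z: "I z" "\<And>y. I y \<Longrightarrow> degree (fst y) \<le> degree (fst z)"
    by blast
  obtain m v where mv: "z = (m, v)" by (cases z)
  have v: "v \<in> V" "is_order m v" using z(1) by (auto simp: I_def mv)
  have "act m w = 0" if w: "w \<in> V" for w
  proof -
    obtain g where g: "is_order g w" using order_exists[OF V w] by metis
    have "g dvd m"
    proof (rule ccontr)
      assume "\<not> g dvd m"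
      then obtain a b h where h: "is_order h (act a v + act b w)" "degree h > degree m"
        using order_not_dvd_increase[OF v(2) g] by metis
      have in_V: "act a v + act b w \<in> V"
        using act_in[OF V] v(1) w subspace_add[OF sV] by auto
      obtain h' where h': "is_order h' (act a v + act b w)" "degree h' \<le> dim V"
        using order_exists[OF V in_V] by metis
      have "h dvd h'" "h' \<noteq> 0"
        using h(1) h'(1) dvd_refl[of h'] unfolding is_order_def by blast+
      then have "degree h \<le> degree h'" by (intro dvd_imp_degree_le)
      then have "I (h, act a v + act b w)" using h(1) h'(2) in_V by (simp add: I_def)
      then show False using z(2)[of "(h, act a v + act b w)"] h(2) by (simp add: mv)
    qed
    then show ?thesis using g by (simp add: is_order_def)
  qed
  then show ?thesis using that v by blast
qed

section \<open>Cyclic subspaces split off\<close>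

lemma linear_extension:
  assumes V: "subspace V"
    and add: "\<And>x y. x \<in> V \<Longrightarrow> y \<in> V \<Longrightarrow> e (x + y) = e x + e y"
    and sc: "\<And>c x. x \<in> V \<Longrightarrow> e (c *s x) = c *s e x"
  obtains f where "lin f" "\<And>x. x \<in> V \<Longrightarrow> f x = e x"
proof -
  interpret vector_space_pair scale scale by unfold_locales
  obtain B where B: "B \<subseteq> V" "independent B" "V \<subseteq> span B"
    using maximal_independent_subset by metis
  obtain f where f: "\<And>x. x \<in> B \<Longrightarrow> f x = e x" "lin f"
    using linear_independent_extend[OF B(2), of e] by blast
  have "subspace {x \<in> V. f x = e x}"
    unfolding subspace_def
    using V add sc lin_add[OF f(2)] lin_scale[OF f(2)] lin_zero[OF f(2)] sc[of 0 0]
    by (auto simp: subspace_0 subspace_add subspace_scale)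
  moreover have "B \<subseteq> {x \<in> V. f x = e x}" using B f by auto
  ultimately have "span B \<subseteq> {x \<in> V. f x = e x}" by (metis span_minimal)
  then show ?thesis using that[of f] f(2) B(3) by blast
qed

lemma projection_exists:
  assumes sub: "subspace V" "subspace W" "subspace W'"
    and sum: "\<And>x. x \<in> V \<Longrightarrow> \<exists>w\<in>W. x - w \<in> W'"
    and disj: "W \<inter> W' \<subseteq> {0}"
  obtains e where "lin e" "\<And>x. x \<in> V \<Longrightarrow> e x \<in> W \<and> x - e x \<in> W'"
    "\<And>x w. x \<in> V \<Longrightarrow> w \<in> W \<Longrightarrow> x - w \<in> W' \<Longrightarrow> e x = w"
proof -
  define e where "e x = (SOME w. w \<in> W \<and> x - w \<in> W')" for x
  have e: "e x \<in> W \<and> x - e x \<in> W'" if "x \<in> V" for x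
    unfolding e_def by (rule someI_ex) (use sum[OF that] in auto)
  have uniq: "e x = w" if "x \<in> V" "w \<in> W" "x - w \<in> W'" for x w
  proof -
    have "e x - w \<in> W" using e[OF that(1)] that(2) sub(2) by (simp add: subspace_diff)
    moreover have "(x - w) - (x - e x) \<in> W'"
      using e[OF that(1)] subspace_diff[OF sub(3) that(3)] by blast
    then have "e x - w \<in> W'" by simp
    ultimately show ?thesis using disj by force
  qed
  have add: "e (x + y) = e x + e y" if "x \<in> V" "y \<in> V" for x y
  proof (rule uniq)
    show "x + y \<in> V" using that sub(1) by (simp add: subspace_add)
    show "e x + e y \<in> W" using e that sub(2) by (simp add: subspace_add)
    have "(x - e x) + (y - e y) \<in> W'" using e that sub(3) by (simp add: subspace_add)
    then show "x + y - (e x + e y) \<in> W'" by (simp add: algebra_simps)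
  qed
  have sc: "e (c *s x) = c *s e x" if "x \<in> V" for c x
  proof (rule uniq)
    show "c *s x \<in> V" using that sub(1) by (simp add: subspace_scale)
    show "c *s e x \<in> W" using e that sub(2) by (simp add: subspace_scale)
    have "c *s (x - e x) \<in> W'" using e that sub(3) by (simp add: subspace_scale)
    then show "c *s x - c *s e x \<in> W'" by (simp add: scale_right_diff_distrib)
  qed
  obtain f where f: "lin f" "\<And>x. x \<in> V \<Longrightarrow> f x = e x"
    using linear_extension[OF sub(1) add sc] by metis
  show ?thesis using that[of f] f e uniq by simp
qed

definition cyclic :: "'v \<Rightarrow> 'v set" where
  "cyclic v = range (\<lambda>f. act f v)"

lemma act_in_cyclic: "act f v \<in> cyclic v" by (simp add: cyclic_def)

lemma subspace_cyclic: "subspace (cyclic v)"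
proof (rule subspaceI)
  show "0 \<in> cyclic v" using act_in_cyclic[of 0 v] by simp
next
  fix x y assume "x \<in> cyclic v" "y \<in> cyclic v"
  then obtain f g where "x = act f v" "y = act g v" by (auto simp: cyclic_def)
  then show "x + y \<in> cyclic v" using act_in_cyclic[of "f + g" v] by (simp add: act_add)
next
  fix c x assume "x \<in> cyclic v"
  then obtain f where "x = act f v" by (auto simp: cyclic_def)
  then show "c *s x \<in> cyclic v" using act_in_cyclic[of "smult c f" v] by (simp add: act_smult)
qed

lemma act_cyclic_closed: "w \<in> cyclic v \<Longrightarrow> act f w \<in> cyclic v"
  by (auto simp: cyclic_def simp flip: act_mult)

lemma invspace_cyclic:
  assumes "invspace V" "v \<in> V"
  shows "invspace (cyclic v)" "cyclic v \<subseteq> V"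
proof -
  show sub: "cyclic v \<subseteq> V" using act_in[OF assms] by (auto simp: cyclic_def)
  have "T x \<in> cyclic v" if "x \<in> cyclic v" for x
    using act_cyclic_closed[OF that, of "[:0, 1:]"] lin_zero[OF lin_T] by simp
  then show "invspace (cyclic v)"
    using findim_mono[OF invspaceD(1)[OF assms(1)] subspace_cyclic sub]
    by (auto simp: invspace_def)
qed

lemma order_functional:
  assumes m: "is_order m v"
  obtains l where "Vector_Spaces.linear scale (*) l"
    "\<And>f. degree f < degree m \<Longrightarrow> l (act f v) = coeff f (degree m - 1)"
proof -
  interpret F: vector_space "(*) :: 'k \<Rightarrow> 'k \<Rightarrow> 'k"
    by unfold_locales (simp_all add: algebra_simps)
  interpret P: vector_space_pair scale "(*) :: 'k \<Rightarrow> 'k \<Rightarrow> 'k" by unfold_locales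
  let ?d = "degree m"
  define g where "g i = act (monom 1 i) v" for i
  have zero: "f = 0" if "degree f < ?d" "act f v = 0" for f
    using m that by (auto simp: is_order_def dest: dvd_imp_degree_le)
  have inj: "inj_on g {..<?d}"
  proof (rule inj_onI)
    fix i j assume ij: "i \<in> {..<?d}" "j \<in> {..<?d}" "g i = g j"
    let ?f = "monom 1 i - monom (1::'k) j"
    have "degree ?f < ?d"
    proof (cases "i \<le> j")
      case True
      then have "degree ?f \<le> j" by (intro degree_diff_le) (auto simp: degree_monom_eq)
      then show ?thesis using ij by simp
    next
      case False
      then have "degree ?f \<le> i" by (intro degree_diff_le) (auto simp: degree_monom_eq)
      then show ?thesis using ij by simp
    qed
    moreover have "act ?f v = 0" using ij(3) by (simp add: act_diff g_def)
    ultimately have "?f = 0" by (rule zero)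
    then have "monom 1 i = monom (1::'k) j" by simp
    then show "i = j" by (metis degree_monom_eq zero_neq_one)
  qed
  have ind: "independent (g ` {..<?d})"
  proof
    assume "dependent (g ` {..<?d})"
    then obtain u where u: "\<exists>b\<in>g ` {..<?d}. u b \<noteq> 0" "(\<Sum>b\<in>g ` {..<?d}. u b *s b) = 0"
      by (auto simp: dependent_finite)
    let ?f = "\<Sum>i<?d. monom (u (g i)) i"
    have coeff: "coeff ?f i = (if i < ?d then u (g i) else 0)" for i
      by (simp add: coeff_sum)
    obtain i where i: "i < ?d" "u (g i) \<noteq> 0" using u(1) by auto
    have "degree ?f \<le> ?d - 1" by (rule degree_le) (auto simp: coeff)
    then have "degree ?f < ?d" using i(1) by simp
    moreover have "act ?f v = (\<Sum>i<?d. u (g i) *s g i)"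
    proof -
      have "act (monom (u (g i)) i) v = u (g i) *s g i" for i
        using act_smult[of "u (g i)" "monom 1 i" v] by (simp add: smult_monom g_def)
      then show ?thesis by (simp add: act_sum)
    qed
    then have "act ?f v = 0" using u(2) inj by (simp add: sum.reindex)
    ultimately have "?f = 0" by (rule zero)
    then show False using coeff[of i] i by simp
  qed
  obtain l where l: "\<And>x. x \<in> g ` {..<?d} \<Longrightarrow> l x = (if x = g (?d - 1) then 1 else 0)"
    "Vector_Spaces.linear scale (*) l"
    using P.linear_independent_extend[OF ind, of "\<lambda>x. if x = g (?d - 1) then 1 else 0"] by blast
  have lg: "l (g i) = (if i = ?d - 1 then 1 else 0)" if "i < ?d" for i
    using l(1)[of "g i"] that inj_onD[OF inj, of i "?d - 1"] by auto
  have "l (act f v) = coeff f (?d - 1)" if "degree f < ?d" for f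
  proof -
    have "l (act f v) = (\<Sum>i\<le>degree f. coeff f i * l (g i))"
      by (subst act_sum_monom)
        (simp add: P.linear_sum[OF l(2)] P.linear_scale[OF l(2)] g_def)
    also have "\<dots> = (\<Sum>i\<le>degree f. if i = ?d - 1 then coeff f i else 0)"
      using that by (intro sum.cong) (auto simp: lg)
    also have "\<dots> = coeff f (?d - 1)"
      by (simp add: coeff_eq_0)
    finally show ?thesis .
  qed
  then show ?thesis using that l(2) by blast
qed

text \<open>A cyclic space of maximal order splits off: if \<open>l\<close> is a functional that reads off the top
coefficient (of degree \<open>deg m - 1\<close>) on \<open>K[x] v\<close>, then the vectors \<open>y\<close> with \<open>l (f y) = 0\<close> for all
\<open>f\<close> form an invariant complement. It meets \<open>K[x] v\<close> trivially because a nonzero remainder modulo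
\<open>m\<close> can be shifted to degree \<open>deg m - 1\<close>.\<close>

lemma cyclic_projection:
  assumes V: "invspace V" and v: "v \<in> V" and m: "is_order m v"
    and max: "\<And>w. w \<in> V \<Longrightarrow> act m w = 0"
  obtains e where "lin e" "\<And>x. x \<in> V \<Longrightarrow> e x \<in> cyclic v"
    "\<And>w. w \<in> cyclic v \<Longrightarrow> e w = w" "\<And>x. x \<in> V \<Longrightarrow> e (T x) = T (e x)"
proof -
  let ?d = "degree m"
  let ?W = "cyclic v"
  interpret F: vector_space "(*) :: 'k \<Rightarrow> 'k \<Rightarrow> 'k"
    by unfold_locales (simp_all add: algebra_simps)
  interpret P: vector_space_pair scale "(*) :: 'k \<Rightarrow> 'k \<Rightarrow> 'k" by unfold_locales
  obtain l where l: "Vector_Spaces.linear scale (*) l"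
    "\<And>f. degree f < ?d \<Longrightarrow> l (act f v) = coeff f (?d - 1)"
    using order_functional[OF m] by metis
  note l_simps = P.linear_add[OF l(1)] P.linear_scale[OF l(1)] P.linear_0[OF l(1)]
    P.linear_diff[OF l(1)]
  have m0: "m \<noteq> 0" using m by (simp add: is_order_def)
  have sV: "subspace V" using V by (rule invspaceD)
  have WV: "?W \<subseteq> V" using invspace_cyclic[OF V v] by simp
  define W' where "W' = {y \<in> V. \<forall>f. l (act f y) = 0}"
  have sW': "subspace W'"
    using sV unfolding W'_def subspace_def by (auto simp: act_lin_simps l_simps)
  have mod_m: "act f y = act (f mod m) y" if "y \<in> V" for f y
  proof -
    have "f = (f div m) * m + f mod m" by simp
    then have "act f y = act (f div m) (act m y) + act (f mod m) y"
      by (metis act_add act_mult)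
    then show ?thesis using max[OF that] by (simp add: act_lin_simps)
  qed
  have mod_less: "f mod m = 0 \<or> degree (f mod m) < ?d" for f
    using degree_mod_less[OF m0] by blast
  have in_W': "y \<in> W'" if y: "y \<in> V" and van: "\<And>i. i < ?d \<Longrightarrow> l (act (monom 1 i) y) = 0" for y
  proof -
    have "l (act f y) = 0" for f
    proof -
      let ?r = "f mod m"
      show ?thesis
      proof (cases "?r = 0")
        case True
        then show ?thesis using mod_m[OF y, of f] by (simp add: l_simps)
      next
        case False
        then have deg: "degree ?r < ?d" using mod_less[of f] by blast
        have "l (act f y) = l (act ?r y)" using mod_m[OF y, of f] by simp
        also have "\<dots> = (\<Sum>i\<le>degree ?r. coeff ?r i * l (act (monom 1 i) y))"
          by (subst act_sum_monom) (simp add: P.linear_sum[OF l(1)] l_simps)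
        also have "\<dots> = 0" using deg van by (intro sum.neutral) auto
        finally show ?thesis .
      qed
    qed
    then show ?thesis using y by (simp add: W'_def)
  qed
  have disj: "?W \<inter> W' \<subseteq> {0}"
  proof
    fix w assume w: "w \<in> ?W \<inter> W'"
    then obtain h where h: "w = act h v" by (auto simp: cyclic_def)
    let ?r = "h mod m"
    have wr: "w = act ?r v" using h mod_m[OF v] by simp
    show "w \<in> {0}"
    proof (cases "?r = 0")
      case True
      then show ?thesis using wr by simp
    next
      case False
      then have deg: "degree ?r < ?d" using mod_less by blast
      let ?f = "monom (1::'k) (?d - 1 - degree ?r)"
      have "degree (?f * ?r) = ?d - 1"
        using False deg by (simp add: degree_mult_eq degree_monom_eq)
      then have "l (act ?f w) = lead_coeff (?f * ?r)"
        using l(2)[of "?f * ?r"] deg by (simp add: wr act_mult)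
      also have "\<dots> = lead_coeff ?r" by (simp add: lead_coeff_mult degree_monom_eq)
      finally show ?thesis using w False by (simp add: W'_def)
    qed
  qed
  have sum: "\<exists>w\<in>?W. x - w \<in> W'" if x: "x \<in> V" for x
  proof -
    \<comment> \<open>The equations for \<open>i = 0, 1, ...\<close> are triangular: a multiple of \<open>x\<^bsup>deg m - 1 - j\<^esup> v\<close>
      changes the value for \<open>i = j\<close> and leaves those for \<open>i < j\<close> unchanged.\<close>
    have "\<exists>f. \<forall>i<j. l (act (monom 1 i) (x - act f v)) = 0" if "j \<le> ?d" for j
      using that
    proof (induction j)
      case 0
      then show ?case by simp
    next
      case (Suc j)
      then obtain f where f: "\<And>i. i < j \<Longrightarrow> l (act (monom 1 i) (x - act f v)) = 0" by auto
      define c where "c = l (act (monom 1 j) (x - act f v))"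
      let ?p = "monom (1::'k) (?d - 1 - j)"
      have "l (act (monom 1 i) (x - act (f + smult c ?p) v)) = 0" if i: "i < Suc j" for i
      proof -
        have "l (act (monom 1 i) (act ?p v)) = l (act (monom 1 (i + (?d - 1 - j))) v)"
          by (simp add: mult_monom flip: act_mult)
        also have "\<dots> = (if i = j then 1 else 0)"
          using Suc.prems i by (subst l(2)) (auto simp: degree_monom_eq)
        finally have p: "l (act (monom 1 i) (act ?p v)) = (if i = j then 1 else 0)" .
        have "l (act (monom 1 i) (x - act (f + smult c ?p) v)) =
          l (act (monom 1 i) (x - act f v)) - c * l (act (monom 1 i) (act ?p v))"
          by (simp add: act_add act_smult act_lin_simps l_simps algebra_simps)
        also have "\<dots> = 0" unfolding p using f i c_def by (auto simp: less_Suc_eq)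
        finally show ?thesis .
      qed
      then show ?case by blast
    qed
    then obtain f where f: "\<And>i. i < ?d \<Longrightarrow> l (act (monom 1 i) (x - act f v)) = 0" by blast
    have "x - act f v \<in> V" using sV x act_in[OF V v] by (simp add: subspace_diff)
    then have "x - act f v \<in> W'" using f by (rule in_W')
    then show ?thesis using act_in_cyclic by blast
  qed
  obtain e where e: "lin e" "\<And>x. x \<in> V \<Longrightarrow> e x \<in> ?W \<and> x - e x \<in> W'"
    "\<And>x w. x \<in> V \<Longrightarrow> w \<in> ?W \<Longrightarrow> x - w \<in> W' \<Longrightarrow> e x = w"
    using projection_exists[OF sV subspace_cyclic sW' sum disj] by metis
  have "e w = w" if "w \<in> ?W" for w
    using e(3)[of w w] that WV subspace_0[OF sW'] by auto
  moreover have "e (T x) = T (e x)" if x: "x \<in> V" for x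
  proof (rule e(3))
    show "T x \<in> V" using invspaceD(3)[OF V x] .
    show "T (e x) \<in> ?W" using invspaceD(3)[OF invspace_cyclic(1)[OF V v]] e(2)[OF x] by blast
    have xe: "x - e x \<in> W'" using e(2)[OF x] by simp
    have "l (act f (T (x - e x))) = 0" for f
    proof -
      have "act f (T (x - e x)) = act (pCons 0 f) (x - e x)" by (simp add: act_T)
      then show ?thesis using xe unfolding W'_def by (simp del: act_pCons)
    qed
    then have "T (x - e x) \<in> W'" using invspaceD(3)[OF V] xe by (auto simp: W'_def)
    then show "T x - T (e x) \<in> W'" by (simp add: lin_diff[OF lin_T])
  qed
  ultimately show ?thesis using that[of e] e(1,2) by blast
qed

section \<open>Kernels and Jordan blocks\<close>

lemma dim_split:
  assumes V: "findim V" and e: "lin e" "e ` X \<subseteq> X" "e ` X \<subseteq> W" "\<And>w. w \<in> W \<Longrightarrow> e w = w"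
    and X: "subspace X" "X \<subseteq> V"
  shows "dim X = dim (X \<inter> W) + dim {x \<in> X. e x = 0}"
proof -
  have "e ` X = X \<inter> W"
  proof
    show "e ` X \<subseteq> X \<inter> W" using e by auto
    show "X \<inter> W \<subseteq> e ` X" using e(4) by force
  qed
  then show ?thesis using rank_nullity[OF e(1) findim_mono[OF V X]] by simp
qed

definition Ker :: "'v set \<Rightarrow> 'k poly \<Rightarrow> 'v set" where
  "Ker V f = {x \<in> V. act f x = 0}"

text \<open>The dimension of \<open>Eig V a k\<close>, the part of the eigenspace that lies in the image of \<open>(T - a)\<^sup>k\<close>, is
the number of Jordan blocks for \<open>a\<close> of size greater than \<open>k\<close>.\<close>

definition Eig :: "'v set \<Rightarrow> 'k \<Rightarrow> nat \<Rightarrow> 'v set" where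
  "Eig V a k = {x \<in> V. T x = a *s x \<and> (\<exists>z\<in>V. x = act ([:- a, 1:] ^ k) z)}"

lemma subspace_Ker: "subspace V \<Longrightarrow> subspace (Ker V f)"
  unfolding Ker_def by (rule subspace_kernel[OF lin_act])

lemma subspace_Eig:
  assumes V: "subspace V"
  shows "subspace (Eig V a k)"
proof -
  have "Eig V a k = Ker V [:- a, 1:] \<inter> V \<inter> act ([:- a, 1:] ^ k) ` V"
    unfolding Eig_def Ker_def act_linear by auto
  then show ?thesis
    by (simp only:) (intro subspace_inter subspace_Ker subspace_image lin_act V)
qed

lemma act_eigenvector: "T x = a *s x \<Longrightarrow> act f x = poly f a *s x"
  by (induction f) (simp_all add: lin_simps[OF lin_T] algebra_simps)

end

section \<open>Invariants of a composite\<close>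

locale endo_pair = endo scale T
  for scale :: "'k::field \<Rightarrow> 'v::ab_group_add \<Rightarrow> 'v" (infixr "*s" 75) and T +
  fixes \<alpha> \<beta> :: 'k
  assumes nonzero: "\<alpha> \<noteq> 0" "\<beta> \<noteq> 0"
begin

text \<open>The polynomial \<open>x\<^sup>2 - s x\<close> generates the subring \<open>K[t]\<close> of \<open>K[x]\<close> whose action commutes with
\<open>p\<close> and \<open>q\<close>.\<close>

definition quad :: "'k poly" where "quad = [:0, - (\<alpha> + \<beta>), 1:]"

text \<open>The product of the linear factors at the exceptional values \<open>0\<close>, \<open>\<alpha> + \<beta>\<close>, \<open>\<alpha>\<close>, \<open>\<beta>\<close>.\<close>

definition tau :: "'k poly" where "tau = quad * (quad + [:\<alpha> * \<beta>:])"
definition reflect :: "'k poly \<Rightarrow> 'k poly" where "reflect f = pcompose f [:\<alpha> + \<beta>, - 1:]"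

lemma reflect_simps: "reflect (f + g) = reflect f + reflect g" "reflect (f * g) = reflect f * reflect g" "reflect (f - g) = reflect f - reflect g"
  "reflect 1 = 1" "reflect 0 = 0" "reflect (smult c f) = smult c (reflect f)"
  by (simp_all add: reflect_def pcompose_add pcompose_mult pcompose_diff pcompose_1 pcompose_smult)

lemma reflect_power: "reflect (f ^ k) = reflect f ^ k"
  by (induction k) (simp_all add: reflect_simps)

lemma reflect_reflect: "reflect (reflect f) = f"
proof -
  have "reflect (reflect f) = pcompose f (pcompose [:\<alpha> + \<beta>, - 1:] [:\<alpha> + \<beta>, - 1:])"
    by (simp add: reflect_def pcompose_assoc)
  also have "pcompose [:\<alpha> + \<beta>, - 1:] [:\<alpha> + \<beta>, - 1:] = [:0, 1:]" by (simp add: pcompose_pCons)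
  finally show ?thesis by simp
qed

lemma reflect_quad: "reflect quad = quad"
  by (simp add: reflect_def quad_def pcompose_pCons algebra_simps)

lemma reflect_tau: "reflect tau = tau"
proof -
  have "reflect [:\<alpha> * \<beta>:] = [:\<alpha> * \<beta>:]" by (simp add: reflect_def)
  then show ?thesis by (simp add: tau_def reflect_simps reflect_quad)
qed

lemma reflect_coprime: "coprime f tau \<Longrightarrow> coprime (reflect f) tau"
proof -
  assume "coprime f tau"
  then obtain u w where "u * f + w * tau = 1" using coprime_poly_bezout by metis
  then have "reflect u * reflect f + reflect w * tau = 1"
    using reflect_simps(1,2)[of "u * f" "w * tau"] reflect_simps(2)[of u f] reflect_simps(2)[of w tau]
    by (simp add: reflect_tau reflect_simps(4))
  then show ?thesis by (rule coprime_polyI)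
qed

lemma reflect_linear: "a + b = \<alpha> + \<beta> \<Longrightarrow> reflect [:- a, 1:] = - [:- b, 1:]"
  by (simp add: reflect_def pcompose_pCons algebra_simps)

lemma reflect_linear_power:
  assumes "a + b = \<alpha> + \<beta>"
  shows "reflect ([:- a, 1:] ^ k) = smult ((- 1) ^ k) ([:- b, 1:] ^ k)"
proof -
  have "reflect [:- a, 1:] = smult (- 1) [:- b, 1:]" using reflect_linear[OF assms] by simp
  then show ?thesis by (simp only: reflect_power smult_power)
qed

definition composite_on :: "'v set \<Rightarrow> bool" where
  "composite_on V \<longleftrightarrow> (\<exists>p q. lin p \<and> lin q \<and> p ` V \<subseteq> V \<and> q ` V \<subseteq> V \<and>
     (\<forall>x\<in>V. p (p x) = p x \<and> q (q x) = q x \<and> T x = \<alpha> *s p x + \<beta> *s q x))"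

text \<open>The equation says that \<open>\<tau>(T)\<close> is a relative trace from \<open>K[t]\<close> to \<open>K[x]\<close>. Where \<open>\<tau>(T)\<close> is
invertible this is Higman's criterion for \<open>V\<close> to be projective relative to \<open>K[t]\<close>.\<close>

definition homotopy :: "'v set \<Rightarrow> bool" where
  "homotopy V \<longleftrightarrow> (\<exists>F. lin F \<and> F ` V \<subseteq> V \<and>
     (\<forall>x\<in>V. T (F x) + F (T x) - (\<alpha> + \<beta>) *s F x = act tau x))"

definition balanced :: "'v set \<Rightarrow> bool" where
  "balanced V \<longleftrightarrow> (\<forall>f. coprime f tau \<longrightarrow> dim (Ker V f) = dim (Ker V (reflect f)))"

definition intertwined :: "'v set \<Rightarrow> bool" where
  "intertwined V \<longleftrightarrow> (\<forall>a b k. a + b = \<alpha> + \<beta> \<longrightarrow> poly tau a = 0 \<longrightarrow> a \<noteq> b \<longrightarrow>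
     dim (Eig V a (Suc k)) \<le> dim (Eig V b k))"

lemma act_quad: "act quad x = T (T x) - (\<alpha> + \<beta>) *s T x"
  using lin_zero[OF lin_T] by (simp add: quad_def lin_simps[OF lin_T] algebra_simps)

lemma act_tau: "act tau x = act quad (act quad x) + (\<alpha> * \<beta>) *s act quad x"
  using lin_zero[OF lin_T] by (simp add: tau_def act_mult act_add act_lin_simps)

lemma composite_quad:
  assumes pq: "lin p" "lin q" "p ` V \<subseteq> V" "q ` V \<subseteq> V"
    "\<And>x. x \<in> V \<Longrightarrow> p (p x) = p x \<and> q (q x) = q x \<and> T x = \<alpha> *s p x + \<beta> *s q x"
    and V: "invspace V" and x: "x \<in> V"
  shows "act quad x = (\<alpha> * \<beta>) *s (p (q x) + q (p x) - p x - q x)"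
proof -
  have mem: "p x \<in> V" "q x \<in> V" using pq(3,4) x by auto
  have idem: "p (p y) = p y" "q (q y) = q y" if "y \<in> V" for y using pq(5)[OF that] by auto
  have Tx: "T y = \<alpha> *s p y + \<beta> *s q y" if "y \<in> V" for y using pq(5)[OF that] by auto
  have "T (T x) = \<alpha> *s T (p x) + \<beta> *s T (q x)"
  proof -
    have "T (T x) = T (\<alpha> *s p x + \<beta> *s q x)" by (simp only: Tx[OF x])
    then show ?thesis by (simp only: lin_simps[OF lin_T])
  qed
  then have "act quad x = \<alpha> *s (\<alpha> *s p x + \<beta> *s q (p x)) + \<beta> *s (\<alpha> *s p (q x) + \<beta> *s q x)
      - (\<alpha> + \<beta>) *s (\<alpha> *s p x + \<beta> *s q x)"
    unfolding act_quad by (simp only: Tx[OF mem(1)] Tx[OF mem(2)] Tx[OF x] idem[OF x])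
  also have "\<dots> = (\<alpha> * \<beta>) *s (p (q x) + q (p x) - p x - q x)"
    by (simp add: algebra_simps)
  finally show ?thesis .
qed

text \<open>With \<open>c = (p - q)\<^sup>2\<close>, which is central in the algebra generated by \<open>p\<close> and \<open>q\<close>, the operator
\<open>p q (1 - p)\<close> is sent to \<open>\<beta> c (1 - c)\<close>, while \<open>\<tau>(T) = - \<alpha>\<^sup>2 \<beta>\<^sup>2 c (1 - c)\<close>.\<close>

lemma composite_homotopy:
  assumes V: "invspace V" and c: "composite_on V"
  shows "homotopy V"
proof -
  obtain p q where pq: "lin p" "lin q" "p ` V \<subseteq> V" "q ` V \<subseteq> V"
    "\<And>x. x \<in> V \<Longrightarrow> p (p x) = p x \<and> q (q x) = q x \<and> T x = \<alpha> *s p x + \<beta> *s q x"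
    using c unfolding composite_on_def by blast
  have in_V: "p x \<in> V" "q x \<in> V" if "x \<in> V" for x using pq(3,4) that by auto
  have idem: "p (p x) = p x" "q (q x) = q x" "T x = \<alpha> *s p x + \<beta> *s q x" if "x \<in> V" for x
    using pq(5)[OF that] by auto
  have sV: "subspace V" using V by (rule invspaceD)
  note sub = subspace_add[OF sV] subspace_diff[OF sV] subspace_scale[OF sV]
  define F where "F x = (- (\<alpha> * \<alpha> * \<beta>)) *s (p (q x) - p (q (p x)))" for x
  have F: "lin F"
    by (rule linI) (simp_all add: F_def lin_simps[OF pq(1)] lin_simps[OF pq(2)] algebra_simps)
  have "F x \<in> V" if "x \<in> V" for x
    unfolding F_def by (intro sub in_V that)
  then have FV: "F ` V \<subseteq> V" by blast
  have "T (F x) + F (T x) - (\<alpha> + \<beta>) *s F x = act tau x" if x: "x \<in> V" for x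
  proof -
    note L = lin_simps[OF pq(1)] lin_simps[OF pq(2)]
    have mem: "p x \<in> V" "q x \<in> V" "p (q x) \<in> V" "q (p x) \<in> V" "q (p (q x)) \<in> V"
      "p (q (p x)) \<in> V" "F x \<in> V" using x in_V FV by auto
    have tpV: "act quad x \<in> V" using act_in[OF V x] .
    have D: "act quad y = (\<alpha> * \<beta>) *s (p (q y) + q (p y) - p y - q y)" if "y \<in> V" for y
      using composite_quad[OF pq V that] .
    have tau: "act tau x = (\<alpha> * \<beta>) *s (p (q (act quad x)) + q (p (act quad x)) - p (act quad x) - q (act quad x))
        + (\<alpha> * \<beta>) *s act quad x"
      by (simp only: act_tau D[OF tpV])
    have "act tau x = (\<alpha> * \<beta> * \<alpha> * \<beta>) *s
      (p (q (p (q x))) + q (p (q (p x))) - p (q (p x)) - q (p (q x)))"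
      unfolding tau unfolding D[OF x]
      by (simp add: L idem x mem algebra_simps)
    moreover have "T (F x) + F (T x) - (\<alpha> + \<beta>) *s F x = (\<alpha> * \<beta> * \<alpha> * \<beta>) *s
      (p (q (p (q x))) + q (p (q (p x))) - p (q (p x)) - q (p (q x)))"
      unfolding idem(3)[OF mem(7)] idem(3)[OF x] unfolding F_def
      by (simp add: L idem x mem algebra_simps)
    ultimately show ?thesis by simp
  qed
  then show ?thesis using F FV unfolding homotopy_def by blast
qed

text \<open>The properties of the commutator \<open>q p - p q\<close> from which balance and intertwining are derived.\<close>

definition twist :: "'v set \<Rightarrow> ('v \<Rightarrow> 'v) \<Rightarrow> bool" where
  "twist V g \<longleftrightarrow> lin g \<and> g ` V \<subseteq> V \<and>
     (\<forall>x\<in>V. g (T x) = (\<alpha> + \<beta>) *s g x - T (g x)) \<and>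
     (\<forall>x\<in>V. act tau x = (\<alpha> * \<beta> * \<alpha> * \<beta>) *s g (g x))"

lemma composite_twist:
  assumes V: "invspace V" and c: "composite_on V"
  obtains g where "twist V g"
proof -
  obtain p q where pq: "lin p" "lin q" "p ` V \<subseteq> V" "q ` V \<subseteq> V"
    "\<And>x. x \<in> V \<Longrightarrow> p (p x) = p x \<and> q (q x) = q x \<and> T x = \<alpha> *s p x + \<beta> *s q x"
    using c unfolding composite_on_def by blast
  have in_V: "p x \<in> V" "q x \<in> V" if "x \<in> V" for x using pq(3,4) that by auto
  have idem: "p (p x) = p x" "q (q x) = q x" "T x = \<alpha> *s p x + \<beta> *s q x" if "x \<in> V" for x
    using pq(5)[OF that] by auto
  have sV: "subspace V" using V by (rule invspaceD)
  note sub = subspace_add[OF sV] subspace_diff[OF sV] subspace_scale[OF sV]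
  note L = lin_simps[OF pq(1)] lin_simps[OF pq(2)]
  define g where "g x = q (p x) - p (q x)" for x
  have "lin g" by (rule linI) (simp_all add: g_def L algebra_simps)
  moreover have "g x \<in> V" if "x \<in> V" for x
    unfolding g_def by (intro sub in_V that)
  then have gV: "g ` V \<subseteq> V" by blast
  moreover have "g (T x) = (\<alpha> + \<beta>) *s g x - T (g x)" if x: "x \<in> V" for x
  proof -
    have mem: "p x \<in> V" "q x \<in> V" "p (q x) \<in> V" "q (p x) \<in> V" "g x \<in> V"
      using x in_V gV by auto
    show ?thesis unfolding idem(3)[OF mem(5)] idem(3)[OF x] unfolding g_def
      by (simp add: L idem x mem algebra_simps)
  qed
  moreover have "act tau x = (\<alpha> * \<beta> * \<alpha> * \<beta>) *s g (g x)" if x: "x \<in> V" for x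
  proof -
    have mem: "p x \<in> V" "q x \<in> V" "p (q x) \<in> V" "q (p x) \<in> V" "q (p (q x)) \<in> V"
      "p (q (p x)) \<in> V" using x in_V by auto
    have tpV: "act quad x \<in> V" using act_in[OF V x] .
    have D: "act quad y = (\<alpha> * \<beta>) *s (p (q y) + q (p y) - p y - q y)" if "y \<in> V" for y
      using composite_quad[OF pq V that] .
    have tau: "act tau x = (\<alpha> * \<beta>) *s (p (q (act quad x)) + q (p (act quad x)) - p (act quad x) - q (act quad x))
        + (\<alpha> * \<beta>) *s act quad x"
      by (simp only: act_tau D[OF tpV])
    show ?thesis
      unfolding tau unfolding D[OF x] unfolding g_def
      by (simp add: L idem x mem algebra_simps)
  qed
  ultimately show ?thesis using that unfolding twist_def by blast
qed

lemma twistD: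
  assumes "twist V g"
  shows "lin g" "\<And>x. x \<in> V \<Longrightarrow> g x \<in> V" "\<And>x. x \<in> V \<Longrightarrow> g (T x) = (\<alpha> + \<beta>) *s g x - T (g x)"
    "\<And>x. x \<in> V \<Longrightarrow> act tau x = (\<alpha> * \<beta> * \<alpha> * \<beta>) *s g (g x)"
  using assms by (auto simp: twist_def)

lemma twist_act:
  assumes V: "invspace V" and g: "twist V g" and x: "x \<in> V"
  shows "g (act f x) = act (reflect f) (g x)"
proof (induction f)
  case 0
  show ?case using lin_zero[OF twistD(1)[OF g]] by (simp add: reflect_simps)
next
  case (pCons a f)
  have "reflect (pCons a f) = [:a:] + (smult (\<alpha> + \<beta>) (reflect f) - pCons 0 (reflect f))"
    by (simp add: reflect_def pcompose_pCons)
  then have A: "act (reflect (pCons a f)) (g x) =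
      a *s g x + ((\<alpha> + \<beta>) *s act (reflect f) (g x) - T (act (reflect f) (g x)))"
    by (simp only: act_add act_diff act_smult act_pCons act_0) (simp add: lin_zero[OF lin_T])
  have "g (act (pCons a f) x) = a *s g x + g (T (act f x))"
    by (simp add: lin_simps[OF twistD(1)[OF g]])
  also have "\<dots> = act (reflect (pCons a f)) (g x)"
    by (simp only: A twistD(3)[OF g act_in[OF V x]] pCons(2))
  finally show ?case .
qed

lemma twist_Ker_le:
  assumes V: "invspace V" and g: "twist V g" and f: "coprime f tau"
  shows "dim (Ker V f) \<le> dim (Ker V (reflect f))"
proof -
  have sV: "subspace V" using V by (rule invspaceD)
  have fin: "findim (Ker V h)" for h
    by (rule findim_mono[OF invspaceD(1)[OF V] subspace_Ker[OF sV]]) (auto simp: Ker_def)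
  obtain u w where bez: "u * f + w * tau = 1" using coprime_poly_bezout[OF f] by metis
  have "x = 0" if x: "x \<in> Ker V f" "g x = 0" for x
  proof -
    have "act tau x = 0" using twistD(4)[OF g] x lin_zero[OF twistD(1)[OF g]] by (simp add: Ker_def)
    moreover have "act f x = 0" using x by (simp add: Ker_def)
    ultimately have "act (u * f + w * tau) x = 0" by (simp add: act_add act_mult act_lin_simps)
    then show ?thesis by (simp add: bez)
  qed
  then have "{x \<in> Ker V f. g x = 0} \<subseteq> {0}" by auto
  then have "{x \<in> Ker V f. g x = 0} \<subseteq> span {}" by simp
  then have "dim {x \<in> Ker V f. g x = 0} = 0" using dim_le_card[of _ "{}"] by simp
  then have "dim (Ker V f) = dim (g ` Ker V f)"
    using rank_nullity[OF twistD(1)[OF g] fin[of f]] by simp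
  also have "\<dots> \<le> dim (Ker V (reflect f))"
  proof (rule dim_mono_findim[OF fin subspace_image[OF twistD(1)[OF g] subspace_Ker[OF sV]]])
    show "g ` Ker V f \<subseteq> Ker V (reflect f)"
    proof
      fix y assume "y \<in> g ` Ker V f"
      then obtain x where x: "x \<in> V" "act f x = 0" "y = g x" by (auto simp: Ker_def)
      then show "y \<in> Ker V (reflect f)"
        using twist_act[OF V g x(1), of f] twistD(2)[OF g] lin_zero[OF twistD(1)[OF g]]
        by (simp add: Ker_def)
    qed
  qed
  finally show ?thesis .
qed

lemma composite_balanced:
  assumes V: "invspace V" and c: "composite_on V"
  shows "balanced V"
  unfolding balanced_def
proof (intro allI impI antisym)
  obtain g where g: "twist V g" using composite_twist[OF assms] .
  fix f assume f: "coprime f tau"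
  show "dim (Ker V f) \<le> dim (Ker V (reflect f))" using twist_Ker_le[OF V g f] .
  show "dim (Ker V (reflect f)) \<le> dim (Ker V f)"
    using twist_Ker_le[OF V g reflect_coprime[OF f]] by (simp add: reflect_reflect)
qed

text \<open>The derivative of \<open>\<tau>\<close> at \<open>a\<close> is \<open>(2 a - s)(2 t(a) + \<alpha> \<beta>)\<close>; the first factor is \<open>a - b\<close>, and the
second one is \<open>\<alpha> \<beta>\<close> or \<open>- \<alpha> \<beta>\<close> because \<open>t(a)\<close> is \<open>0\<close> or \<open>- \<alpha> \<beta>\<close>.\<close>

lemma tau_simple_root:
  assumes ab: "a + b = \<alpha> + \<beta>" "a \<noteq> b" and root: "poly tau a = 0"
  obtains h where "tau = h * [:- a, 1:]" "poly h a \<noteq> 0"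
proof -
  obtain h where h: "tau = [:- a, 1:] * h" using root by (auto simp: poly_eq_0_iff_dvd elim: dvdE)
  have "pderiv tau = [:- a, 1:] * pderiv h + h * pderiv [:- a, 1:]"
    unfolding h by (rule pderiv_mult)
  then have "poly (pderiv tau) a = poly h a" by (simp add: pderiv_pCons)
  moreover have "poly (pderiv tau) a = (a - b) * (2 * poly quad a + \<alpha> * \<beta>)"
  proof -
    have "poly (pderiv quad) a = a - b" using ab(1) by (simp add: quad_def pderiv_pCons algebra_simps)
    then show ?thesis
      by (simp add: tau_def pderiv_mult pderiv_add pderiv_pCons pderiv_smult algebra_simps
          del: diff_eq_eq eq_diff_eq)
  qed
  moreover have "2 * poly quad a + \<alpha> * \<beta> \<noteq> 0"
  proof -
    have "poly quad a = 0 \<or> poly quad a = - (\<alpha> * \<beta>)"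
      using root by (auto simp: tau_def add_eq_0_iff)
    then show ?thesis using nonzero by auto
  qed
  ultimately have "poly h a \<noteq> 0" using ab(2) by (metis mult_eq_0_iff right_minus_eq)
  then show ?thesis using that[of h] h by (simp add: mult.commute)
qed

text \<open>Between the generalized eigenspaces of \<open>a\<close> and \<open>b\<close> the operator \<open>g\<close> goes back and forth, and
\<open>g\<^sup>2\<close> agrees with \<open>T - a\<close> up to a unit. With \<open>Y = Eig V a (k + 1)\<close> and \<open>Z = Eig V b k\<close>
this gives \<open>g Y \<subseteq> Z \<inter> ker g\<close> and \<open>Y \<inter> ker g \<subseteq> g Z\<close>, and the rank formula for \<open>g\<close> on \<open>Y\<close> and on
\<open>Z\<close> yields the inequality.\<close>

lemma composite_intertwined:
  assumes V: "invspace V" and c: "composite_on V"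
  shows "intertwined V"
  unfolding intertwined_def
proof (intro allI impI)
  fix a b k assume ab: "a + b = \<alpha> + \<beta>" and root: "poly tau a = 0" and ne: "a \<noteq> b"
  obtain g where g: "twist V g" using composite_twist[OF assms] .
  note g_lin = lin_simps[OF twistD(1)[OF g]]
  obtain h where h: "tau = h * [:- a, 1:]" "poly h a \<noteq> 0"
    using tau_simple_root[OF ab ne root] .
  have sV: "subspace V" using V by (rule invspaceD)
  let ?Y = "Eig V a (Suc k)" and ?Z = "Eig V b k"
  have fin: "findim (Eig V c j)" for c j
    by (rule findim_mono[OF invspaceD(1)[OF V] subspace_Eig[OF sV]]) (auto simp: Eig_def)
  have fin_img: "findim (g ` ?Z)" by (rule findim_image[OF twistD(1)[OF g] fin])
  have s_img: "subspace (g ` ?Y)" by (rule subspace_image[OF twistD(1)[OF g] subspace_Eig[OF sV]])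
  have g_pow: "g (act ([:- a, 1:] ^ j) z) = act ([:- b, 1:] ^ j) ((- 1) ^ j *s g z)"
    if "z \<in> V" for j z
    using twist_act[OF V g that] reflect_linear_power[OF ab] by (simp add: act_smult act_lin_simps)
  have g_eig: "T (g x) = b *s g x" if "x \<in> V" "g (T x) = a *s g x" for x
  proof -
    have b: "b = \<alpha> + \<beta> - a" using ab by (simp add: algebra_simps)
    have "T (g x) = (\<alpha> + \<beta>) *s g x - a *s g x" using twistD(3)[OF g that(1)] that(2) by simp
    also have "\<dots> = b *s g x" using b by (simp add: scale_left_diff_distrib)
    finally show ?thesis .
  qed
  have 1: "g ` ?Y \<subseteq> {z \<in> ?Z. g z = 0}"
  proof
    fix w assume "w \<in> g ` ?Y"
    then obtain y z where y: "w = g y" "y \<in> V" "T y = a *s y" "z \<in> V" "y = act ([:- a, 1:] ^ Suc k) z"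
      by (auto simp: Eig_def simp del: power_Suc)
    have "act tau y = 0" using act_eigenvector[OF y(3)] root by simp
    then have "g w = 0" using twistD(4)[OF g y(2)] nonzero y(1) by simp
    moreover have "T w = b *s w" using g_eig[OF y(2)] y(1,3) by (simp add: g_lin)
    moreover have "w = act ([:- b, 1:] ^ k) (act [:- b, 1:] ((- 1) ^ Suc k *s g z))"
      unfolding y(1,5) g_pow[OF y(4)] by (simp only: power_Suc2 act_mult)
    moreover have "act [:- b, 1:] ((- 1) ^ Suc k *s g z) \<in> V"
      using act_in[OF V] subspace_scale[OF sV] twistD(2)[OF g y(4)] by blast
    moreover have "w \<in> V" using twistD(2)[OF g y(2)] y(1) by simp
    ultimately show "w \<in> {z \<in> ?Z. g z = 0}" unfolding Eig_def by blast
  qed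
  have 2: "{y \<in> ?Y. g y = 0} \<subseteq> g ` ?Z"
  proof
    fix y assume "y \<in> {y \<in> ?Y. g y = 0}"
    then obtain z where y: "y \<in> V" "T y = a *s y" "g y = 0" "z \<in> V" "y = act ([:- a, 1:] ^ Suc k) z"
      by (auto simp: Eig_def simp del: power_Suc)
    define w where "w = act ([:- a, 1:] ^ k) z"
    have wV: "w \<in> V" using act_in[OF V y(4)] by (simp add: w_def)
    have yw: "y = act [:- a, 1:] w" unfolding y(5) w_def by (rule act_power)
    have "act tau w = poly h a *s y"
      by (simp only: h(1) act_mult yw[symmetric] act_eigenvector[OF y(2)])
    then have gg: "(\<alpha> * \<beta> * \<alpha> * \<beta>) *s g (g w) = poly h a *s y"
      using twistD(4)[OF g wV] by simp
    define c where "c = \<alpha> * \<beta> * \<alpha> * \<beta> / poly h a"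
    have "g (c *s g w) = y"
    proof -
      have "g (c *s g w) = (1 / poly h a) *s ((\<alpha> * \<beta> * \<alpha> * \<beta>) *s g (g w))"
        by (simp add: g_lin c_def)
      also have "\<dots> = y" unfolding gg using h(2) by simp
      finally show ?thesis .
    qed
    moreover have "c *s g w \<in> ?Z"
    proof -
      have "T w = a *s w + y" using yw by simp
      then have "g (T w) = a *s g w" by (simp add: g_lin y(3))
      then have "T (c *s g w) = b *s (c *s g w)"
        using g_eig[OF wV] by (simp add: lin_simps[OF lin_T] mult.commute)
      moreover have "c *s g w = act ([:- b, 1:] ^ k) (c *s ((- 1) ^ k *s g z))"
        unfolding w_def g_pow[OF y(4)] by (simp add: act_lin_simps)
      moreover have "c *s ((- 1) ^ k *s g z) \<in> V" "c *s g w \<in> V"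
        using subspace_scale[OF sV] twistD(2)[OF g] y(4) wV by blast+
      ultimately show ?thesis unfolding Eig_def by blast
    qed
    ultimately show "y \<in> g ` ?Z" by (metis imageI)
  qed
  have "dim ?Y = dim {y \<in> ?Y. g y = 0} + dim (g ` ?Y)"
    by (rule rank_nullity[OF twistD(1)[OF g] fin])
  also have "\<dots> \<le> dim (g ` ?Z) + dim {z \<in> ?Z. g z = 0}"
  proof (rule add_mono)
    show "dim {y \<in> ?Y. g y = 0} \<le> dim (g ` ?Z)"
      by (rule dim_mono_findim[OF fin_img subspace_kernel[OF twistD(1)[OF g] subspace_Eig[OF sV]] 2])
    have "findim {z \<in> ?Z. g z = 0}"
      by (rule findim_mono[OF fin subspace_kernel[OF twistD(1)[OF g] subspace_Eig[OF sV]]]) auto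
    then show "dim (g ` ?Y) \<le> dim {z \<in> ?Z. g z = 0}"
      by (rule dim_mono_findim[OF _ s_img 1])
  qed
  also have "\<dots> = dim ?Z" using rank_nullity[OF twistD(1)[OF g] fin[of b k]] by simp
  finally show "dim ?Y \<le> dim ?Z" .
qed

end

section \<open>Composites on cyclic spaces\<close>

primrec odd_part_coeffs :: "'k::comm_ring_1 \<Rightarrow> 'k list \<Rightarrow> 'k poly" where
  "odd_part_coeffs s [] = 0"
| "odd_part_coeffs s (c # cs) = Poly cs + [:s, - 1:] * odd_part_coeffs s cs"

text \<open>Every \<open>f\<close> is uniquely \<open>a(t) + x b(t)\<close> with \<open>t = x\<^sup>2 - s x\<close>, and \<open>odd_part s f\<close> is \<open>b(t)\<close>. The
recursion expresses that \<open>odd_part\<close> solves the homotopy equation with right-hand side \<open>1\<close> on \<open>K[x]\<close>.\<close>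

definition odd_part :: "'k::comm_ring_1 \<Rightarrow> 'k poly \<Rightarrow> 'k poly" where
  "odd_part s f = odd_part_coeffs s (coeffs f)"

lemma odd_part_0 [simp]: "odd_part s 0 = 0"
  by (simp add: odd_part_def)

lemma odd_part_pCons [simp]: "odd_part s (pCons c f) = f + [:s, - 1:] * odd_part s f"
  by (simp add: odd_part_def cCons_def)

lemma odd_part_add: "odd_part s (f + g) = odd_part s f + odd_part s g"
  by (induction f g rule: poly_induct2) (simp_all add: algebra_simps del: mult_pCons_left)

lemma odd_part_smult: "odd_part s (smult c f) = smult c (odd_part s f)"
  by (induction f) (simp_all add: smult_add_right del: mult_pCons_left)

lemma odd_part_diff: "odd_part s (f - g) = odd_part s f - odd_part s g"
  using odd_part_add[of s "f - g" g] by simp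

lemma odd_part_X: "odd_part s ([:0, 1:] * f) = f + [:s, - 1:] * odd_part s f"
  using odd_part_pCons[of s 0 f] by (simp del: odd_part_pCons)

lemma odd_part_even_mult: "odd_part s (pcompose g [:0, - s, 1:] * f) = pcompose g [:0, - s, 1:] * odd_part s f"
proof (induction g)
  case 0
  show ?case by simp
next
  case (pCons c g)
  let ?X = "[:0, 1:] :: 'a poly" and ?t = "[:0, - s, 1:]"
  have t: "?t = ?X * ?X - smult s ?X" by simp
  have tt: "odd_part s (?t * h) = ?t * odd_part s h" for h
  proof -
    have "?t * h = ?X * (?X * h) - smult s (?X * h)" unfolding t by (simp add: algebra_simps)
    then have "odd_part s (?t * h) =
        (?X * h + [:s, - 1:] * (h + [:s, - 1:] * odd_part s h)) - smult s (h + [:s, - 1:] * odd_part s h)"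
      by (simp only: odd_part_diff odd_part_smult odd_part_X)
    also have "\<dots> = ?t * odd_part s h"
      by (simp add: algebra_simps smult_add_right)
    finally show ?thesis .
  qed
  have "odd_part s (pcompose (pCons c g) ?t * f) = odd_part s (smult c f + ?t * (pcompose g ?t * f))"
    by (simp add: pcompose_pCons algebra_simps)
  also have "\<dots> = smult c (odd_part s f) + ?t * (pcompose g ?t * odd_part s f)"
    by (simp only: odd_part_add odd_part_smult tt pCons(2))
  also have "\<dots> = pcompose (pCons c g) ?t * odd_part s f"
    by (simp add: pcompose_pCons algebra_simps)
  finally show ?case .
qed

lemma even_odd_decomposition:
  obtains a b where "f = pcompose a [:0, - s, 1:] + [:0, 1:] * pcompose b [:0, - s, 1:]"
    "odd_part s f = pcompose b [:0, - s, 1:]"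
proof -
  let ?t = "[:0, - s, 1:]" and ?X = "[:0, 1:] :: 'a poly"
  have "\<exists>a b. f = pcompose a ?t + ?X * pcompose b ?t"
  proof (induction f)
    case 0
    show ?case by (rule exI[of _ 0], rule exI[of _ 0]) simp
  next
    case (pCons c f)
    then obtain a b where f: "f = pcompose a ?t + ?X * pcompose b ?t" by blast
    have "pCons c f = [:c:] + ?X * f" by simp
    also have "\<dots> = pcompose (pCons c b) ?t + ?X * pcompose (a + smult s b) ?t"
      unfolding f by (simp add: pcompose_pCons pcompose_add pcompose_smult algebra_simps)
    finally show ?case by blast
  qed
  then obtain a b where f: "f = pcompose a ?t + ?X * pcompose b ?t" by blast
  have "odd_part s (pcompose a ?t) = 0" "odd_part s (pcompose b ?t) = 0"
    using odd_part_even_mult[of s a 1] odd_part_even_mult[of s b 1] by (simp_all add: one_pCons)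
  then have "odd_part s f = pcompose b ?t"
    unfolding f by (simp only: odd_part_add odd_part_X) simp
  then show ?thesis using that f by blast
qed

lemma odd_part_mult_odd_part: "odd_part s (odd_part s f * g) = odd_part s f * odd_part s g"
  using even_odd_decomposition[of f s] odd_part_even_mult by metis

lemma odd_part_degree: "odd_part s f = 0 \<or> degree (odd_part s f) < degree f"
proof (induction f)
  case 0
  show ?case by simp
next
  case (pCons c f)
  show ?case
  proof (cases "f = 0")
    case True
    then show ?thesis by simp
  next
    case False
    have "degree ([:s, - 1:] * odd_part s f) \<le> degree f"
    proof (cases "odd_part s f = 0")
      case True
      then show ?thesis by simp
    next
      case False
      have "degree ([:s, - 1:] * odd_part s f) \<le> degree [:s, - 1:] + degree (odd_part s f)"
        by (rule degree_mult_le)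
      also have "\<dots> \<le> degree f" using pCons(2) False by simp
      finally show ?thesis .
    qed
    then have "degree (odd_part s (pCons c f)) \<le> degree f"
      unfolding odd_part_pCons by (intro degree_add_le) simp_all
    then show ?thesis using False by simp
  qed
qed

context endo_pair
begin

lemma composite_onI:
  assumes "lin p" "lin q" "\<And>x. x \<in> V \<Longrightarrow> p x \<in> V" "\<And>x. x \<in> V \<Longrightarrow> q x \<in> V"
    "\<And>x. x \<in> V \<Longrightarrow> p (p x) = p x" "\<And>x. x \<in> V \<Longrightarrow> q (q x) = q x"
    "\<And>x. x \<in> V \<Longrightarrow> T x = \<alpha> *s p x + \<beta> *s q x"
  shows "composite_on V"
  unfolding composite_on_def
  by (intro exI[of _ p] exI[of _ q] conjI ballI image_subsetI assms)

lemma composite_on_swap: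
  assumes "endo_pair.composite_on scale T \<beta> \<alpha> V"
  shows "composite_on V"
proof -
  interpret sw: endo_pair scale T \<beta> \<alpha> by unfold_locales (use nonzero in auto)
  obtain p q where "lin p" "lin q" "p ` V \<subseteq> V" "q ` V \<subseteq> V"
    "\<forall>x\<in>V. p (p x) = p x \<and> q (q x) = q x \<and> T x = \<beta> *s p x + \<alpha> *s q x"
    using assms unfolding sw.composite_on_def by blast
  then show ?thesis unfolding composite_on_def
    by (intro exI[of _ q] exI[of _ p]) (simp add: add.commute)
qed

text \<open>The assumption \<open>P_X\<close> says that \<open>Q = (x - \<alpha> P) / \<beta>\<close> is idempotent, once \<open>P\<close> is. As \<open>P\<close> preserves the ideal
of \<open>m\<close>, both maps descend from \<open>K[x]\<close> to the cyclic space.\<close>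

lemma cyclic_composite:
  assumes V: "invspace V" and v: "v \<in> V" and m: "is_order m v"
    and P_add: "\<And>f g. P (f + g) = P f + P g" and P_smult: "\<And>c f. P (smult c f) = smult c (P f)"
    and P_idem: "\<And>f. P (P f) = P f"
    and P_X: "\<And>f. [:\<alpha>:] * ([:0, 1:] * P f + P ([:0, 1:] * f)) =
      [:0, 1:] * ([:0, 1:] * f) - [:\<beta>:] * ([:0, 1:] * f) + [:\<alpha>:] * ([:\<alpha> + \<beta>:] * P f)"
    and P_m: "\<And>f. m dvd f \<Longrightarrow> m dvd P f"
  shows "composite_on (cyclic v)"
proof -
  let ?W = "cyclic v" and ?X = "[:0, 1:] :: 'k poly"
  have W: "invspace ?W" using invspace_cyclic[OF V v] by simp
  have actX: "act (?X * f) x = T (act f x)" for f x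
    using lin_zero[OF lin_T] by (simp add: act_mult)
  have act_const: "act ([:c:] * f) x = c *s act f x" for c f x
    by (simp add: act_smult)
  define p0 where "p0 w = act (P (SOME f. w = act f v)) v" for w
  have p0: "p0 (act f v) = act (P f) v" for f
  proof -
    define h where "h = (SOME h. act f v = act h v)"
    have "act f v = act h v" unfolding h_def by (rule someI[of _ f]) simp
    then have "act (f - h) v = 0" by (simp add: act_diff)
    then have "m dvd P (f - h)" using m P_m by (simp add: is_order_def)
    then have "act (P (f - h)) v = 0" using m by (simp add: is_order_def)
    moreover have "P f = P (f - h) + P h" using P_add[of "f - h" h] by simp
    ultimately show ?thesis by (simp add: p0_def h_def act_add)
  qed
  obtain p where p: "lin p" "\<And>w. w \<in> ?W \<Longrightarrow> p w = p0 w"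
  proof (rule linear_extension[OF subspace_cyclic, of v p0])
    fix x y assume "x \<in> ?W" "y \<in> ?W"
    then obtain f g where "x = act f v" "y = act g v" unfolding cyclic_def by blast
    then show "p0 (x + y) = p0 x + p0 y"
      using p0[of "f + g"] p0[of f] p0[of g] by (simp add: act_add P_add)
  next
    fix c x assume "x \<in> ?W"
    then obtain f where "x = act f v" by (auto simp: cyclic_def)
    then show "p0 (c *s x) = c *s p0 x"
      using p0[of "smult c f"] p0[of f] by (simp add: act_smult P_smult)
  qed (use that in blast)
  have p_act: "p (act f v) = act (P f) v" for f using p(2)[OF act_in_cyclic] p0 by simp
  define q where "q x = (1 / \<beta>) *s (T x - \<alpha> *s p x)" for x
  have lin_q: "lin q" unfolding q_def by (intro lin_scaled lin_minus lin_T p(1))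
  note L = lin_simps[OF lin_T] lin_simps[OF p(1)]
  have pW: "p x \<in> ?W" if x: "x \<in> ?W" for x
  proof -
    obtain f where "x = act f v" using x unfolding cyclic_def by blast
    then show ?thesis using p_act[of f] act_in_cyclic by simp
  qed
  have sW: "subspace ?W" by (rule subspace_cyclic)
  have qW: "q x \<in> ?W" if "x \<in> ?W" for x
    unfolding q_def
    by (intro subspace_scale[OF sW] subspace_diff[OF sW] invspaceD(3)[OF W] pW that)
  have idem: "p (p x) = p x" if x: "x \<in> ?W" for x
  proof -
    obtain f where "x = act f v" using x unfolding cyclic_def by blast
    then show ?thesis by (simp only: p_act P_idem)
  qed
  have key: "\<alpha> *s (T (p x) + p (T x)) = T (T x) - \<beta> *s T x + (\<alpha> * (\<alpha> + \<beta>)) *s p x"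
    if xW: "x \<in> ?W" for x
  proof -
    obtain f where x: "x = act f v" using xW unfolding cyclic_def by blast
    have Tp: "T (p x) = act (?X * P f) v" by (simp only: x p_act actX)
    have pT: "p (T x) = act (P (?X * f)) v"
      using p_act[of "?X * f"] by (simp only: actX x)
    have "\<alpha> *s (T (p x) + p (T x)) = act ([:\<alpha>:] * (?X * P f + P (?X * f))) v"
      by (simp only: act_const act_add Tp pT)
    also have "\<dots> = T (T x) - \<beta> *s T x + (\<alpha> * (\<alpha> + \<beta>)) *s p x"
      unfolding P_X x p_act by (simp only: act_const act_add act_diff actX scale_scale)
    finally show ?thesis .
  qed
  have Tq: "T x = \<alpha> *s p x + \<beta> *s q x" for x using nonzero by (simp add: q_def)
  have qq: "q (q x) = q x" if x: "x \<in> ?W" for x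
  proof -
    have bq: "\<beta> *s q y = T y - \<alpha> *s p y" for y using Tq[of y] by simp
    have "\<beta> *s (\<beta> *s q (q x)) = T (\<beta> *s q x) - \<alpha> *s p (\<beta> *s q x)"
      unfolding bq[of "q x"] by (simp only: scale_right_diff_distrib L scale_left_commute)
    also have "\<dots> = T (T x) - \<alpha> *s T (p x) - \<alpha> *s p (T x) + (\<alpha> * \<alpha>) *s p x"
      unfolding bq by (simp add: L idem[OF x] scale_right_diff_distrib)
    also have "\<dots> = T (T x) - \<alpha> *s (T (p x) + p (T x)) + (\<alpha> * \<alpha>) *s p x"
      by (simp add: algebra_simps)
    also have "\<dots> = \<beta> *s (T x - \<alpha> *s p x)" unfolding key[OF x]
      by (simp add: distrib_left scale_left_distrib scale_right_diff_distrib mult.commute)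
    also have "\<dots> = \<beta> *s (\<beta> *s q x)" unfolding bq ..
    finally show ?thesis using nonzero by simp
  qed
  show ?thesis by (rule composite_onI[OF p(1) lin_q pW qW idem qq Tq])
qed

text \<open>The idempotent is \<open>P f = f + odd_part f \<cdot> r\<close> with \<open>r = (x - s)(x - \<alpha>) / \<alpha>\<close>, the projection of
\<open>K[x]\<close> onto \<open>K[t]\<close> with kernel \<open>K[t] r\<close>. It preserves the ideals of
all divisors of \<open>r\<close>, and by \<open>K[t]\<close>-linearity those of their products with polynomials in \<open>t\<close>.\<close>

lemma cyclic_composite_shifted:
  assumes V: "invspace V" and v: "v \<in> V" and m: "is_order (e * pcompose g quad) v"
    and e: "e dvd [:- (\<alpha> + \<beta>), 1:] * [:- \<alpha>, 1:]"
  shows "composite_on (cyclic v)"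
proof -
  let ?l = "odd_part (\<alpha> + \<beta>)"
  define r where "r = smult (1 / \<alpha>) ([:- (\<alpha> + \<beta>), 1:] * [:- \<alpha>, 1:])"
  have r: "[:\<alpha>:] * r = ([:0, 1:] - [:\<alpha> + \<beta>:]) * ([:0, 1:] - [:\<alpha>:])"
    using nonzero by (simp add: r_def algebra_simps)
  have lr: "?l r = - 1"
    using nonzero by (simp add: r_def odd_part_smult field_simps one_pCons)
  define P where "P f = f + ?l f * r" for f
  show ?thesis
  proof (rule cyclic_composite[OF V v m, of P])
    show "P (f + h) = P f + P h" for f h by (simp add: P_def odd_part_add algebra_simps)
    show "P (smult c f) = smult c (P f)" for c f by (simp add: P_def odd_part_smult smult_add_right)
    show "P (P f) = P f" for f
      by (simp add: P_def odd_part_add odd_part_mult_odd_part lr)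
    show "e * pcompose g quad dvd P f" if f: "e * pcompose g quad dvd f" for f
    proof -
      obtain k where "f = e * pcompose g quad * k" using f by (rule dvdE)
      then have k: "f = pcompose g quad * (e * k)" by (simp only: mult_ac)
      have "e dvd r" unfolding r_def by (rule dvd_smult[OF e])
      then have "e dvd e * k + ?l (e * k) * r" by simp
      then have "pcompose g quad * e dvd pcompose g quad * (e * k + ?l (e * k) * r)"
        by (rule mult_dvd_mono[OF dvd_refl])
      moreover have "?l f = pcompose g quad * ?l (e * k)"
        unfolding k quad_def by (rule odd_part_even_mult)
      then have "P f = pcompose g quad * (e * k + ?l (e * k) * r)"
        by (simp add: P_def k algebra_simps)
      ultimately show ?thesis by (simp add: mult.commute)
    qed
    fix f
    define X :: "'k poly" where "X = [:0, 1:]"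
    define A B where "A = [:\<alpha>:]" and "B = [:\<beta>:]"
    have S: "[:\<alpha> + \<beta>:] = A + B" by (simp add: A_def B_def)
    have lX: "?l (X * f) = f + (A + B - X) * ?l f"
      unfolding X_def odd_part_X by (simp add: A_def B_def)
    have Ar: "A * r = (X - (A + B)) * (X - A)" using r unfolding S by (simp add: A_def X_def)
    have "A * (X * P f + P (X * f)) = 2 * A * X * f + (A * r) * (f + (A + B) * ?l f)"
      unfolding P_def lX by (simp add: algebra_simps)
    also have "\<dots> = X * (X * f) - B * (X * f) + A * (A + B) * f + (A + B) * ?l f * (A * r)"
      unfolding Ar by (simp add: algebra_simps)
    also have "\<dots> = X * (X * f) - B * (X * f) + A * ((A + B) * P f)"
      unfolding P_def by (simp add: algebra_simps)
    finally show "[:\<alpha>:] * ([:0, 1:] * P f + P ([:0, 1:] * f)) =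
      [:0, 1:] * ([:0, 1:] * f) - [:\<beta>:] * ([:0, 1:] * f) + [:\<alpha>:] * ([:\<alpha> + \<beta>:] * P f)"
      unfolding S unfolding A_def B_def X_def .
  qed
qed

text \<open>The idempotent \<open>P f = odd_part f \<cdot> x (x - \<beta>) / \<alpha>\<close> arises from that of the preceding lemma by
replacing \<open>P\<close> with \<open>1 - P\<close> and \<open>x\<close> with \<open>s - x\<close>.\<close>

lemma cyclic_composite_unshifted:
  assumes V: "invspace V" and v: "v \<in> V" and m: "is_order (e * pcompose g quad) v"
    and e: "e dvd [:0, 1:] * [:- \<beta>, 1:]"
  shows "composite_on (cyclic v)"
proof -
  let ?l = "odd_part (\<alpha> + \<beta>)"
  define r where "r = smult (1 / \<alpha>) ([:0, 1:] * [:- \<beta>, 1:])"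
  have r: "[:\<alpha>:] * r = [:0, 1:] * ([:0, 1:] - [:\<beta>:])"
    using nonzero by (simp add: r_def algebra_simps)
  have lr: "?l r = 1"
    using nonzero by (simp add: r_def odd_part_smult field_simps one_pCons)
  define P where "P f = ?l f * r" for f
  show ?thesis
  proof (rule cyclic_composite[OF V v m, of P])
    show "P (f + h) = P f + P h" for f h by (simp add: P_def odd_part_add algebra_simps)
    show "P (smult c f) = smult c (P f)" for c f by (simp add: P_def odd_part_smult)
    show "P (P f) = P f" for f
      by (simp add: P_def odd_part_mult_odd_part lr)
    show "e * pcompose g quad dvd P f" if f: "e * pcompose g quad dvd f" for f
    proof -
      obtain k where "f = e * pcompose g quad * k" using f by (rule dvdE)
      then have k: "f = pcompose g quad * (e * k)" by (simp only: mult_ac)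
      have "e dvd r" unfolding r_def by (rule dvd_smult[OF e])
      then have "e dvd ?l (e * k) * r" by simp
      then have "pcompose g quad * e dvd pcompose g quad * (?l (e * k) * r)"
        by (rule mult_dvd_mono[OF dvd_refl])
      moreover have "?l f = pcompose g quad * ?l (e * k)"
        unfolding k quad_def by (rule odd_part_even_mult)
      then have "P f = pcompose g quad * (?l (e * k) * r)"
        by (simp add: P_def)
      ultimately show ?thesis by (simp add: mult.commute)
    qed
    fix f
    define X :: "'k poly" where "X = [:0, 1:]"
    define A B where "A = [:\<alpha>:]" and "B = [:\<beta>:]"
    have S: "[:\<alpha> + \<beta>:] = A + B" by (simp add: A_def B_def)
    have lX: "?l (X * f) = f + (A + B - X) * ?l f"
      unfolding X_def odd_part_X by (simp add: A_def B_def)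
    have Ar: "A * r = X * (X - B)" using r by (simp add: A_def B_def X_def)
    have "A * (X * P f + P (X * f)) = (A * r) * f + A * ((A + B) * P f)"
      unfolding P_def lX by (simp add: algebra_simps)
    also have "\<dots> = X * (X * f) - B * (X * f) + A * ((A + B) * P f)"
      unfolding Ar by (simp add: algebra_simps)
    finally show "[:\<alpha>:] * ([:0, 1:] * P f + P ([:0, 1:] * f)) =
      [:0, 1:] * ([:0, 1:] * f) - [:\<beta>:] * ([:0, 1:] * f) + [:\<alpha>:] * ([:\<alpha> + \<beta>:] * P f)"
      unfolding S unfolding A_def B_def X_def .
  qed
qed

lemma cyclic_composite_order:
  assumes V: "invspace V" and v: "v \<in> V" and m: "is_order (e0 * e1 * pcompose g quad) v"
    and e0: "e0 dvd [:0, 1:] \<or> e0 dvd [:- (\<alpha> + \<beta>), 1:]"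
    and e1: "e1 dvd [:- \<alpha>, 1:] \<or> e1 dvd [:- \<beta>, 1:]"
  shows "composite_on (cyclic v)"
proof -
  interpret sw: endo_pair scale T \<beta> \<alpha> by unfold_locales (use nonzero in auto)
  have quad: "sw.quad = quad" by (simp add: quad_def sw.quad_def add.commute)
  consider "e0 dvd [:0, 1:]" "e1 dvd [:- \<alpha>, 1:]" | "e0 dvd [:0, 1:]" "e1 dvd [:- \<beta>, 1:]"
    | "e0 dvd [:- (\<alpha> + \<beta>), 1:]" "e1 dvd [:- \<alpha>, 1:]"
    | "e0 dvd [:- (\<alpha> + \<beta>), 1:]" "e1 dvd [:- \<beta>, 1:]"
    using e0 e1 by blast
  then show ?thesis
  proof cases
    case 1
    then show ?thesis
      using sw.cyclic_composite_unshifted[OF V v, of "e0 * e1" g] m mult_dvd_mono[OF 1]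
      by (intro composite_on_swap) (simp only: quad)
  next
    case 2
    then show ?thesis
      using cyclic_composite_unshifted[OF V v, of "e0 * e1" g] m mult_dvd_mono[OF 2] by simp
  next
    case 3
    then show ?thesis
      using cyclic_composite_shifted[OF V v, of "e0 * e1" g] m mult_dvd_mono[OF 3] by simp
  next
    case 4
    then show ?thesis
      using sw.cyclic_composite_shifted[OF V v, of "e0 * e1" g] m mult_dvd_mono[OF 4]
      by (intro composite_on_swap) (simp only: quad add.commute)
  qed
qed

end

section \<open>Sufficiency of the invariants\<close>

lemma coprime_linear:
  fixes f :: "'k::field poly"
  assumes "poly f a \<noteq> 0"
  shows "coprime [:- a, 1:] f"
  using coprime_prime_poly[OF prime_elem_linear_field_poly, of 1 "- a" f] assms
  by (simp add: poly_eq_0_iff_dvd)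

text \<open>If the multiplicities of \<open>a\<close> and \<open>b\<close> differ by at most one, at most one linear factor is left over
after the powers of \<open>(x - a)(x - b)\<close> have been collected. For \<open>a = b\<close> this is a matter of parity.\<close>

lemma split_linear_pair:
  fixes m :: "'k::field poly"
  assumes m: "m \<noteq> 0" and ord: "a = b \<or> (order a m \<le> order b m + 1 \<and> order b m \<le> order a m + 1)"
  obtains e j m' where "m = e * ([:- a, 1:] * [:- b, 1:]) ^ j * m'"
    "e dvd [:- a, 1:] \<or> e dvd [:- b, 1:]" "poly m' a \<noteq> 0" "poly m' b \<noteq> 0"
    "\<forall>c. c \<noteq> a \<longrightarrow> c \<noteq> b \<longrightarrow> order c m' = order c m"
proof -
  let ?p = "[:- a, 1:]" and ?q = "[:- b, 1:]"
  note split_thesis = that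
  have main: thesis if split: "m = e * (?p * ?q) ^ j * m'" and e: "e = 1 \<or> e = ?p \<or> e = ?q"
    and roots: "poly m' a \<noteq> 0" "poly m' b \<noteq> 0" for e j m'
  proof (rule split_thesis[OF split _ roots])
    show "e dvd ?p \<or> e dvd ?q" using e by auto
    show "\<forall>c. c \<noteq> a \<longrightarrow> c \<noteq> b \<longrightarrow> order c m' = order c m"
    proof (intro allI impI)
      fix c assume c: "c \<noteq> a" "c \<noteq> b"
      have "poly e c \<noteq> 0" "poly ?p c \<noteq> 0" "poly ?q c \<noteq> 0" using e c by auto
      then have "poly (e * (?p * ?q) ^ j) c \<noteq> 0"
        unfolding poly_mult poly_power by (simp only: mult_eq_0_iff power_eq_0_iff simp_thms)
      then have "order c (e * (?p * ?q) ^ j) = 0" by (rule order_0I)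
      then show "order c m' = order c m"
        using order_mult[of "e * (?p * ?q) ^ j" m' c] m unfolding split[symmetric] by simp
    qed
  qed
  obtain m1 where m1: "m = ?p ^ order a m * m1" "\<not> ?p dvd m1" using order_decomp[OF m] by blast
  have m1_0: "m1 \<noteq> 0" using m1(2) by auto
  have m1a: "poly m1 a \<noteq> 0" using m1(2) by (simp add: poly_eq_0_iff_dvd)
  show thesis
  proof (cases "a = b")
    case True
    obtain j i where ji: "order a m = i + 2 * j" "i = 0 \<or> i = 1"
      by (metis add.commute mod_mult_div_eq not_mod_2_eq_0_eq_1)
    have "?p ^ order a m = ?p ^ i * (?p * ?q) ^ j"
      unfolding ji(1) power_add power_mult using True by (simp only: power2_eq_square)
    then have "m = ?p ^ i * (?p * ?q) ^ j * m1" using m1(1) by simp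
    then show thesis by (rule main) (use ji(2) m1a True in auto)
  next
    case False
    have "order b (?p ^ order a m) = 0" by (rule order_0I) (use False in auto)
    moreover have "?p ^ order a m * m1 \<noteq> 0" using m1(1) m by simp
    then have "order b m = order b (?p ^ order a m) + order b m1"
      using order_mult[of "?p ^ order a m" m1 b] m1(1) by simp
    ultimately have ob: "order b m1 = order b m" by simp
    obtain m2 where m2: "m1 = ?q ^ order b m * m2" "\<not> ?q dvd m2"
      using order_decomp[OF m1_0, of b] unfolding ob by blast
    have roots: "poly m2 a \<noteq> 0" "poly m2 b \<noteq> 0"
      using m1a m2 by (auto simp: poly_eq_0_iff_dvd)
    have m_eq: "m = ?p ^ order a m * ?q ^ order b m * m2" using m1(1) m2(1) by (simp add: mult.assoc)
    consider "order a m = order b m" | "order a m = Suc (order b m)" | "order b m = Suc (order a m)"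
      using ord False by linarith
    then show thesis
    proof cases
      case 1
      have "m = 1 * (?p * ?q) ^ order b m * m2"
        by (subst m_eq, simp only: 1 power_mult_distrib mult_1_left)
      then show thesis by (rule main) (use roots in auto)
    next
      case 2
      have "m = ?p * (?p * ?q) ^ order b m * m2"
        by (subst m_eq, simp only: 2 power_mult_distrib power_Suc mult_ac)
      then show thesis by (rule main) (use roots in auto)
    next
      case 3
      have "m = ?q * (?p * ?q) ^ order a m * m2"
        by (subst m_eq, simp only: 3 power_mult_distrib power_Suc mult_ac)
      then show thesis by (rule main) (use roots in auto)
    qed
  qed
qed

context endo
begin

lemma is_orderD: "is_order m v \<Longrightarrow> act f v = 0 \<longleftrightarrow> m dvd f"
  by (simp add: is_order_def)

lemma is_order_self: "is_order m v \<Longrightarrow> act m v = 0"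
  by (simp add: is_order_def)

lemma dim_pos_iff:
  assumes "findim X"
  shows "dim X > 0 \<longleftrightarrow> (\<exists>x\<in>X. x \<noteq> 0)"
proof
  assume d: "dim X > 0"
  show "\<exists>x\<in>X. x \<noteq> 0"
  proof (rule ccontr)
    assume "\<not> (\<exists>x\<in>X. x \<noteq> 0)"
    then have "X \<subseteq> span {}" by auto
    then show False using dim_le_card[of X "{}"] d by simp
  qed
next
  assume "\<exists>x\<in>X. x \<noteq> 0"
  then obtain x where x: "x \<in> X" "x \<noteq> 0" by blast
  then show "dim X > 0" using findim_independent(2)[OF assms, of "{x}"] by simp
qed

lemma findim_Eig: "invspace V \<Longrightarrow> findim (Eig V a k)"
  by (rule findim_mono[OF invspaceD(1) subspace_Eig[OF invspaceD(2)]]) (auto simp: Eig_def)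

lemma findim_Ker: "invspace V \<Longrightarrow> findim (Ker V f)"
  by (rule findim_mono[OF invspaceD(1) subspace_Ker[OF invspaceD(2)]]) (auto simp: Ker_def)

text \<open>A Jordan block for \<open>a\<close> of size greater than \<open>k\<close> needs \<open>(x - a)\<^bsup>k + 1\<^esup>\<close> in the minimal polynomial.\<close>

lemma Eig_nonzero_order:
  assumes m: "m \<noteq> 0" and max: "\<And>w. w \<in> V \<Longrightarrow> act m w = 0" and y: "y \<in> Eig V a k" "y \<noteq> 0"
  shows "k < order a m"
proof (rule ccontr)
  let ?p = "[:- a, 1:]"
  assume "\<not> k < order a m"
  then have k: "k = (k - order a m) + order a m" by simp
  obtain z where z: "T y = a *s y" "z \<in> V" "y = act (?p ^ k) z" using y(1) by (auto simp: Eig_def)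
  obtain m1 where m1: "m = ?p ^ order a m * m1" "\<not> ?p dvd m1" using order_decomp[OF m] by blast
  have "m1 * ?p ^ k = ?p ^ (k - order a m) * m"
    by (subst k, subst (2) m1(1), simp only: power_add mult_ac)
  then have "act m1 y = act (?p ^ (k - order a m)) (act m z)"
    unfolding z(3) act_mult[symmetric] by simp
  also have "\<dots> = 0" using max[OF z(2)] by (simp add: act_lin_simps)
  finally have "poly m1 a *s y = 0" using act_eigenvector[OF z(1)] by simp
  then show False using y(2) m1(2) by (simp add: poly_eq_0_iff_dvd)
qed

lemma order_Eig_nonzero:
  assumes m: "is_order m v" and k: "k < order a m"
  obtains y where "y \<in> Eig (cyclic v) a k" "y \<noteq> 0"
proof -
  let ?p = "[:- a, 1:]"
  have "?p ^ Suc k dvd m" using k order_1[of a m] by (meson Suc_leI le_imp_power_dvd dvd_trans)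
  then obtain m1 where m1: "m = ?p ^ Suc k * m1" by (rule dvdE)
  define y where "y = act (?p ^ k) (act m1 v)"
  have "T y - a *s y = act (?p ^ Suc k * m1) v"
    unfolding y_def act_linear[symmetric] by (simp only: power_Suc act_mult)
  also have "\<dots> = 0" using m m1 by (simp add: is_order_def)
  finally have "T y = a *s y" by simp
  moreover have "y \<noteq> 0"
  proof
    assume "y = 0"
    then have "act (?p ^ k * m1) v = 0" by (simp only: y_def act_mult)
    then have "m dvd ?p ^ k * m1" using is_orderD[OF m] by blast
    moreover have "?p ^ k * m1 \<noteq> 0" using m m1 by (auto simp: is_order_def)
    ultimately have "degree m \<le> degree (?p ^ k * m1)" by (rule dvd_imp_degree_le)
    moreover have "m = ?p * (?p ^ k * m1)" unfolding m1 by (simp only: power_Suc mult.assoc)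
    then have "degree m = Suc (degree (?p ^ k * m1))"
      using \<open>?p ^ k * m1 \<noteq> 0\<close> degree_mult_eq[of ?p "?p ^ k * m1"] by simp
    ultimately show False by simp
  qed
  moreover have "y \<in> cyclic v" "act m1 v \<in> cyclic v"
    unfolding y_def using act_in_cyclic act_cyclic_closed by blast+
  ultimately have "y \<in> Eig (cyclic v) a k" unfolding Eig_def y_def by blast
  then show ?thesis using \<open>y \<noteq> 0\<close> by (rule that)
qed

text \<open>This expresses the dimension of \<open>Eig\<close> by kernels of polynomials in \<open>T\<close>, which are easier to follow
under a field extension.\<close>

lemma dim_Ker_power:
  assumes V: "invspace V"
  shows "dim (Ker V ([:- a, 1:] ^ Suc k)) = dim (Ker V ([:- a, 1:] ^ k)) + dim (Eig V a k)"
proof -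
  let ?p = "[:- a, 1:]"
  have eig: "T y = a *s y \<longleftrightarrow> act ?p y = 0" for y by (simp only: act_linear right_minus_eq)
  have suc: "act (?p ^ Suc k) x = act ?p (act (?p ^ k) x)" for x by (rule act_power)
  have "{x \<in> Ker V (?p ^ Suc k). act (?p ^ k) x = 0} = Ker V (?p ^ k)"
    unfolding Ker_def suc by (auto simp: act_lin_simps simp del: act_linear)
  moreover have "act (?p ^ k) ` Ker V (?p ^ Suc k) = Eig V a k"
    unfolding Ker_def Eig_def eig suc using act_in[OF V] by (auto simp del: act_linear)
  ultimately show ?thesis
    using rank_nullity[OF lin_act[of "?p ^ k"] findim_Ker[OF V, of "?p ^ Suc k"]] by (simp only:)
qed

text \<open>A cyclic space has at most one Jordan block for each eigenvalue: an eigenvector for \<open>a\<close> is a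
multiple of \<open>(m / (x - a)) v\<close>.\<close>

lemma dim_Eig_cyclic:
  assumes m: "is_order m v"
  shows "dim (Eig (cyclic v) a k) \<le> 1"
proof -
  let ?p = "[:- a, 1:]"
  have "\<exists>u. Eig (cyclic v) a k \<subseteq> span {u}"
  proof (cases "?p dvd m")
    case True
    then obtain m1 where m1: "m = ?p * m1" by (rule dvdE)
    have eig: "T (act m1 v) = a *s act m1 v"
    proof -
      have "T (act m1 v) - a *s act m1 v = act m v"
        unfolding m1 act_mult by (simp only: act_linear)
      then show ?thesis using is_order_self[OF m] by simp
    qed
    have "Eig (cyclic v) a k \<subseteq> span {act m1 v}"
    proof
      fix y assume y: "y \<in> Eig (cyclic v) a k"
      then obtain f where f: "y = act f v" by (auto simp: Eig_def cyclic_def)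
      have "T y = a *s y" using y by (simp add: Eig_def)
      then have "act ?p y = 0" by (simp only: act_linear) simp
      then have "act (?p * f) v = 0" unfolding f by (simp only: act_mult)
      then have "?p * m1 dvd ?p * f" using m unfolding is_order_def m1 by blast
      then have "m1 dvd f" by (metis dvd_mult_cancel_left pCons_eq_0_iff zero_neq_one)
      then obtain h where "f = m1 * h" by (rule dvdE)
      then have "f = h * m1" by (simp only: mult.commute)
      then have "y = poly h a *s act m1 v" unfolding f by (simp only: act_mult act_eigenvector[OF eig])
      then show "y \<in> span {act m1 v}" by (simp add: span_base span_scale)
    qed
    then show ?thesis by blast
  next
    case False
    then have c: "coprime m ?p"
      using coprime_linear[of m a] by (simp add: poly_eq_0_iff_dvd coprime_commute)
    have "y = 0" if y: "y \<in> Eig (cyclic v) a k" for y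
    proof -
      obtain f where f: "y = act f v" using y by (auto simp: Eig_def cyclic_def)
      have "T y = a *s y" using y by (simp add: Eig_def)
      then have "act ?p y = 0" by (simp only: act_linear) simp
      then have "act (?p * f) v = 0" unfolding f by (simp only: act_mult)
      then have "m dvd ?p * f" using m unfolding is_order_def by blast
      then have "m dvd f" using c by (rule coprime_dvd_mult_poly)
      then show ?thesis using m f by (simp add: is_order_def)
    qed
    then have "Eig (cyclic v) a k \<subseteq> span {0}" by auto
    then show ?thesis by blast
  qed
  then obtain u where "Eig (cyclic v) a k \<subseteq> span {u}" by blast
  then show ?thesis using dim_le_card[of _ "{u}"] by fastforce
qed

end

context endo_pair
begin

text \<open>The homotopy equation makes \<open>F\<close> a twisted derivation. For \<open>f = x\<close> this is the equation
\<open>F T = (s - T) F + \<tau>(T)\<close>; the general case follows from the recursion for \<open>odd_part\<close>.\<close>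

lemma homotopy_act:
  assumes V: "invspace V" and F: "lin F" "F ` V \<subseteq> V"
    and FT: "\<And>x. x \<in> V \<Longrightarrow> T (F x) + F (T x) - (\<alpha> + \<beta>) *s F x = act tau x" and x: "x \<in> V"
  shows "F (act f x) = act (reflect f) (F x) + act (tau * odd_part (\<alpha> + \<beta>) f) x"
proof (induction f)
  case 0
  show ?case using lin_zero[OF F(1)] by (simp add: reflect_simps)
next
  case (pCons a f)
  let ?l = "odd_part (\<alpha> + \<beta>)" and ?k = "[:\<alpha> + \<beta>, - 1:]"
  have k: "act ?k y = (\<alpha> + \<beta>) *s y - T y" for y
    by (simp add: lin_simps[OF lin_T] flip: scale_minus_left) 
       (metis add.inverse_inverse act_1 act_minus diff_conv_add_uminus lin_T lin_scale scale_minus_left scale_one)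
  have reflect: "reflect (pCons a f) = [:a:] + ?k * reflect f" by (simp add: reflect_def pcompose_pCons)
  have "F (T (act f x)) = act tau (act f x) + act ?k (F (act f x))"
    using FT[OF act_in[OF V x, of f]] unfolding k by (simp add: algebra_simps)
  then have "F (act (pCons a f) x) = a *s F x + act tau (act f x) + act ?k (F (act f x))"
    by (simp add: lin_simps[OF F(1)])
  also have "\<dots> = (a *s F x + act ?k (act (reflect f) (F x))) +
      (act tau (act f x) + act ?k (act (tau * ?l f) x))"
    unfolding pCons(2) act_lin_simps(1) by (simp only: add_ac)
  also have "a *s F x + act ?k (act (reflect f) (F x)) = act (reflect (pCons a f)) (F x)"
    unfolding reflect act_add act_mult by simp
  also have "act tau (act f x) + act ?k (act (tau * ?l f) x) = act (tau * ?l (pCons a f)) x"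
  proof -
    have "tau * ?l (pCons a f) = tau * f + ?k * (tau * ?l f)"
      unfolding odd_part_pCons by (simp only: distrib_left mult_ac)
    then show ?thesis by (simp only: act_add act_mult)
  qed
  finally show ?case .
qed

lemma intertwined_order:
  assumes V: "invspace V" and v: "v \<in> V" and m: "is_order m v"
    and max: "\<And>w. w \<in> V \<Longrightarrow> act m w = 0" and it: "intertwined V"
    and ab: "a + b = \<alpha> + \<beta>" "poly tau a = 0" "a \<noteq> b"
  shows "order a m \<le> order b m + 1"
proof (rule ccontr)
  assume "\<not> order a m \<le> order b m + 1"
  then have k: "Suc (order b m) < order a m" by simp
  obtain y where y: "y \<in> Eig (cyclic v) a (Suc (order b m))" "y \<noteq> 0"
    using order_Eig_nonzero[OF m k] by metis
  have "y \<in> Eig V a (Suc (order b m))"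
    using y(1) invspace_cyclic(2)[OF V v] unfolding Eig_def by blast
  then have "dim (Eig V a (Suc (order b m))) > 0"
    using dim_pos_iff[OF findim_Eig[OF V]] y(2) by blast
  moreover have "dim (Eig V a (Suc (order b m))) \<le> dim (Eig V b (order b m))"
    using it ab unfolding intertwined_def by blast
  ultimately have "dim (Eig V b (order b m)) > 0" by simp
  then obtain z where "z \<in> Eig V b (order b m)" "z \<noteq> 0"
    using dim_pos_iff[OF findim_Eig[OF V]] by blast
  then show False using Eig_nonzero_order[OF _ max] m unfolding is_order_def by blast
qed

lemma tau_factor: "tau = [:0, 1:] * [:- (\<alpha> + \<beta>), 1:] * ([:- \<alpha>, 1:] * [:- \<beta>, 1:])"
  by (simp add: tau_def quad_def algebra_simps)

lemma poly_tau: "poly tau a = a * (a - (\<alpha> + \<beta>)) * ((a - \<alpha>) * (a - \<beta>))"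
  unfolding tau_factor by (simp add: algebra_simps)

lemma coprime_tauI:
  assumes "poly f 0 \<noteq> 0" "poly f (\<alpha> + \<beta>) \<noteq> 0" "poly f \<alpha> \<noteq> 0" "poly f \<beta> \<noteq> 0"
  shows "coprime f tau"
proof -
  have "coprime [:0, 1:] f" using coprime_linear[OF assms(1)] by simp
  then have "coprime tau f"
    unfolding tau_factor by (intro coprime_mult_poly coprime_linear assms)
  then show ?thesis by (simp add: coprime_commute)
qed

text \<open>Here \<open>n\<close> stands for \<open>m2\<close>. The annihilator of \<open>v\<close> is \<open>c n\<close>, so \<open>c v\<close> has order \<open>n\<close>. Balance
gives that \<open>n\<close> divides \<open>n(s - x)\<close>. Now \<open>F\<close> is applied to \<open>n c v = 0\<close> by means of
\<open>homotopy_act\<close>, twice. After multiplication by \<open>c\<close> all terms vanish except the one containing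
\<open>odd_part n\<close>, so \<open>n\<close> divides \<open>c \<tau> odd_part n\<close>, hence \<open>odd_part n\<close>, which has smaller degree than \<open>n\<close>.\<close>

lemma generic_factor_even:
  assumes V: "invspace V" and v: "v \<in> V" and m: "is_order (c * m2) v"
    and max: "\<And>w. w \<in> V \<Longrightarrow> act (c * m2) w = 0"
    and h: "homotopy V" and bal: "balanced V"
    and c: "c dvd tau ^ N" and m2: "coprime m2 tau"
  shows "odd_part (\<alpha> + \<beta>) m2 = 0"
proof -
  let ?l = "odd_part (\<alpha> + \<beta>)"
  have cop: "coprime f c" if f: "coprime f tau" for f
  proof -
    have "coprime (tau ^ N) f" using coprime_power_poly[of tau f N] f by (simp add: coprime_commute)
    then show ?thesis using c coprime_divisors[of c "tau ^ N" f f] by (simp add: coprime_commute)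
  qed
  have sub: "Ker V (reflect m2) \<subseteq> Ker V m2"
  proof
    fix y assume "y \<in> Ker V (reflect m2)"
    then have y: "y \<in> V" "act (reflect m2) y = 0" by (auto simp: Ker_def)
    obtain u w where bez: "u * reflect m2 + w * c = 1"
      using coprime_poly_bezout[OF cop[OF reflect_coprime[OF m2]]] by metis
    have "m2 = m2 * (u * reflect m2 + w * c)" by (simp add: bez)
    also have "\<dots> = (m2 * u) * reflect m2 + w * (c * m2)" by (simp add: algebra_simps)
    finally have "act m2 y = act ((m2 * u) * reflect m2 + w * (c * m2)) y" by simp
    also have "\<dots> = 0"
      unfolding act_add act_mult[of "m2 * u" "reflect m2"] act_mult[of w "c * m2"]
      using y max by (simp add: act_lin_simps)
    finally show "y \<in> Ker V m2" using y(1) by (simp add: Ker_def)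
  qed
  have "dim (Ker V m2) = dim (Ker V (reflect m2))" using bal m2 by (simp add: balanced_def)
  then have ker: "Ker V (reflect m2) = Ker V m2"
    using dim_eq_findim[OF findim_Ker[OF V] subspace_Ker[OF invspaceD(2)[OF V]] sub] by simp
  have "act c v \<in> Ker V m2"
    using act_in[OF V v] max[OF v] by (simp add: Ker_def act_mult act_comm[of m2 c])
  then have sgm2: "act (reflect m2) (act c v) = 0" using ker by (auto simp: Ker_def)
  have ord: "is_order m2 (act c v)" using is_order_cofactor[OF m] .
  have "m2 dvd reflect m2" using ord sgm2 by (simp add: is_order_def)
  then obtain k where k: "reflect m2 = m2 * k" by (rule dvdE)
  obtain F where F: "lin F" "F ` V \<subseteq> V"
    "\<And>x. x \<in> V \<Longrightarrow> T (F x) + F (T x) - (\<alpha> + \<beta>) *s F x = act tau x"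
    using h unfolding homotopy_def by blast
  have FA: "F (act f x) = act (reflect f) (F x) + act (tau * ?l f) x" if "x \<in> V" for f x
    by (rule homotopy_act[OF V F(1,2) F(3) that])
  have FV: "F v \<in> V" using F(2) v by blast
  have cv: "act c v \<in> V" using act_in[OF V v] .
  have "0 = F (act m2 (act c v))" using is_order_self[OF ord] lin_zero[OF F(1)] by simp
  also have "\<dots> = act (reflect m2) (F (act c v)) + act (tau * ?l m2) (act c v)" by (rule FA[OF cv])
  also have "F (act c v) = act (reflect c) (F v) + act (tau * ?l c) v" by (rule FA[OF v])
  finally have eq: "0 = act c (act (reflect m2) (act (reflect c) (F v)) + act (reflect m2) (act (tau * ?l c) v)
      + act (tau * ?l m2) (act c v))"
    by (simp add: act_lin_simps)
  have "act c (act (reflect m2) (act (reflect c) (F v))) = act (reflect c * k) (act (c * m2) (F v))"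
    unfolding k act_mult[symmetric] by (simp only: mult_ac)
  then have z1: "act c (act (reflect m2) (act (reflect c) (F v))) = 0" using max[OF FV] by (simp add: act_lin_simps)
  have "act c (act (reflect m2) (act (tau * ?l c) v)) = act (tau * ?l c * k) (act (c * m2) v)"
    unfolding k act_mult[symmetric] by (simp only: mult_ac)
  then have z2: "act c (act (reflect m2) (act (tau * ?l c) v)) = 0" using max[OF v] by (simp add: act_lin_simps)
  have "act c (act (tau * ?l m2) (act c v)) = 0" using eq unfolding act_lin_simps(1) z1 z2 by simp
  then have "act (c * (tau * ?l m2)) (act c v) = 0" by (simp only: act_mult)
  then have "m2 dvd c * (tau * ?l m2)" using ord unfolding is_order_def by blast
  then have "m2 dvd tau * ?l m2" using cop[OF m2] by (rule coprime_dvd_mult_poly)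
  then have "m2 dvd ?l m2" using m2 by (rule coprime_dvd_mult_poly)
  then show ?thesis using odd_part_degree[of "\<alpha> + \<beta>" m2] dvd_imp_degree_le[of m2 "?l m2"] by linarith
qed

text \<open>The minimal polynomial is brought to the form \<open>e0 e1 h(t)\<close> required by \<open>cyclic_composite_order\<close>:
\<open>(x - 0)(x - s)\<close> and \<open>(x - \<alpha>)(x - \<beta>)\<close> are polynomials in \<open>t\<close>, and so is the remaining factor.\<close>

lemma maximal_cyclic_composite:
  assumes V: "invspace V" and v: "v \<in> V" and m: "is_order m v"
    and max: "\<And>w. w \<in> V \<Longrightarrow> act m w = 0"
    and h: "homotopy V" and bal: "balanced V" and it: "intertwined V"
  shows "composite_on (cyclic v)"
proof -
  let ?s = "\<alpha> + \<beta>"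
  have m0: "m \<noteq> 0" using m by (simp add: is_order_def)
  have ord: "order a m \<le> order b m + 1" if "a + b = ?s" "poly tau a = 0" "a \<noteq> b" for a b
    using intertwined_order[OF V v m max it that] .
  have roots: "poly tau 0 = 0" "poly tau ?s = 0" "poly tau \<alpha> = 0" "poly tau \<beta> = 0"
    by (simp_all add: poly_tau)
  have ord0: "0 = ?s \<or> (order 0 m \<le> order ?s m + 1 \<and> order ?s m \<le> order 0 m + 1)"
  proof (rule disjCI)
    assume "\<not> (order 0 m \<le> order ?s m + 1 \<and> order ?s m \<le> order 0 m + 1)"
    then show "0 = ?s" using ord[of 0 ?s, OF _ roots(1)] ord[of ?s 0, OF _ roots(2)] by fastforce
  qed
  obtain e0 i m1 where m1: "m = e0 * ([:- 0, 1:] * [:- ?s, 1:]) ^ i * m1"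
    "e0 dvd [:- 0, 1:] \<or> e0 dvd [:- ?s, 1:]" "poly m1 0 \<noteq> 0" "poly m1 ?s \<noteq> 0"
    "\<forall>c. c \<noteq> 0 \<longrightarrow> c \<noteq> ?s \<longrightarrow> order c m1 = order c m"
    by (rule split_linear_pair[OF m0 ord0], rule that, assumption+)
  have m1_0: "m1 \<noteq> 0" using m1(3) by auto
  have "order \<alpha> m1 = order \<alpha> m" "order \<beta> m1 = order \<beta> m" using m1(5) nonzero by auto
  then have ord1: "\<alpha> = \<beta> \<or> (order \<alpha> m1 \<le> order \<beta> m1 + 1 \<and> order \<beta> m1 \<le> order \<alpha> m1 + 1)"
    using ord[of \<alpha> \<beta>, OF refl roots(3)] ord[of \<beta> \<alpha>, OF add.commute roots(4)] by fastforce
  obtain e1 j m2 where m2: "m1 = e1 * ([:- \<alpha>, 1:] * [:- \<beta>, 1:]) ^ j * m2"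
    "e1 dvd [:- \<alpha>, 1:] \<or> e1 dvd [:- \<beta>, 1:]" "poly m2 \<alpha> \<noteq> 0" "poly m2 \<beta> \<noteq> 0"
    by (rule split_linear_pair[OF m1_0 ord1], rule that, assumption+)
  have m2_roots: "poly m2 0 \<noteq> 0" "poly m2 ?s \<noteq> 0" using m1(3,4) unfolding m2(1) by auto
  have m2_tau: "coprime m2 tau" using coprime_tauI m2_roots m2(3,4) by blast
  \<comment> \<open>These are \<open>t\<close> and \<open>t + \<alpha> \<beta>\<close>.\<close>
  define u0 where "u0 = [:- 0, 1:] * [:- ?s, 1:]"
  define u1 where "u1 = [:- \<alpha>, 1:] * [:- \<beta>, 1:]"
  have u: "tau = u0 * u1" unfolding tau_factor u0_def u1_def by simp
  define c where "c = e0 * u0 ^ i * (e1 * u1 ^ j)"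
  have m_eq: "m = c * m2" unfolding m1(1) m2(1) c_def u0_def u1_def by (simp only: mult.assoc)
  have "e0 dvd tau" using m1(2) unfolding u u0_def by (meson dvd_mult dvd_mult2 dvd_trans dvd_triv_left dvd_triv_right)
  moreover have "e1 dvd tau" using m2(2) unfolding u u1_def by (meson dvd_mult dvd_mult2 dvd_trans dvd_triv_left dvd_triv_right)
  moreover have "u0 ^ i dvd tau ^ i" "u1 ^ j dvd tau ^ j" unfolding u by (simp_all add: dvd_power_same)
  ultimately have "c dvd tau * tau ^ i * (tau * tau ^ j)"
    unfolding c_def by (intro mult_dvd_mono)
  then have c_tau: "c dvd tau ^ (2 + i + j)" by (simp only: power_add power2_eq_square mult_ac)
  have "odd_part ?s m2 = 0"
    using generic_factor_even[OF V v _ _ h bal c_tau m2_tau] m max unfolding m_eq by blast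
  then obtain g where g: "m2 = pcompose g quad"
    using even_odd_decomposition[of m2 ?s] unfolding quad_def by (metis add.right_neutral mult_zero_right)
  have u0: "u0 = pcompose [:0, 1:] quad" by (simp add: u0_def quad_def pcompose_pCons)
  have u1: "u1 = pcompose [:\<alpha> * \<beta>, 1:] quad" by (simp add: u1_def quad_def pcompose_pCons algebra_simps)
  have pow: "pcompose (f ^ k) quad = pcompose f quad ^ k" for f k
    by (induction k) (simp_all add: pcompose_mult pcompose_1)
  have "m = e0 * e1 * pcompose ([:0, 1:] ^ i * [:\<alpha> * \<beta>, 1:] ^ j * g) quad"
    unfolding m_eq c_def u0 u1 g pcompose_mult pow by (simp only: mult_ac)
  then have "is_order (e0 * e1 * pcompose ([:0, 1:] ^ i * [:\<alpha> * \<beta>, 1:] ^ j * g) quad) v"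
    using m by simp
  then show ?thesis by (rule cyclic_composite_order[OF V v]) (use m1(2) m2(2) in auto)
qed

lemma composite_on_sum:
  assumes V: "subspace V" and W: "subspace W" "W \<subseteq> V" and e: "lin e" "\<And>x. x \<in> V \<Longrightarrow> e x \<in> W" "\<And>w. w \<in> W \<Longrightarrow> e w = w"
    and c1: "composite_on W" and c2: "composite_on {x \<in> V. e x = 0}"
  shows "composite_on V"
proof -
  let ?W' = "{x \<in> V. e x = 0}"
  obtain p q where 1: "lin p" "lin q" "p ` W \<subseteq> W" "q ` W \<subseteq> W"
    "\<And>x. x \<in> W \<Longrightarrow> p (p x) = p x \<and> q (q x) = q x \<and> T x = \<alpha> *s p x + \<beta> *s q x"
    using c1 unfolding composite_on_def by blast
  obtain p' q' where 2: "lin p'" "lin q'" "p' ` ?W' \<subseteq> ?W'" "q' ` ?W' \<subseteq> ?W'"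
    "\<And>x. x \<in> ?W' \<Longrightarrow> p' (p' x) = p' x \<and> q' (q' x) = q' x \<and> T x = \<alpha> *s p' x + \<beta> *s q' x"
    using c2 unfolding composite_on_def by blast
  have in_W': "x - e x \<in> ?W'" if x: "x \<in> V" for x
  proof -
    have "e (x - e x) = 0" using e(3)[OF e(2)[OF x]] by (simp add: lin_diff[OF e(1)])
    moreover have "x - e x \<in> V" using subspace_diff[OF V x] e(2)[OF x] W(2) by blast
    ultimately show ?thesis by simp
  qed
  have glue: "lin (\<lambda>x. f (e x) + f' (x - e x)) \<and> (\<forall>x\<in>V. f (e x) + f' (x - e x) \<in> V \<and>
      e (f (e x) + f' (x - e x)) = f (e x) \<and>
      (f (e x) + f' (x - e x)) - e (f (e x) + f' (x - e x)) = f' (x - e x))"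
    if f: "lin f" "f ` W \<subseteq> W" and f': "lin f'" "f' ` ?W' \<subseteq> ?W'" for f f'
  proof (intro conjI ballI)
    show "lin (\<lambda>x. f (e x) + f' (x - e x))"
      by (intro lin_plus lin_comp[OF f(1) e(1)] lin_comp[OF f'(1) lin_minus[OF lin_id e(1)]])
    fix x assume x: "x \<in> V"
    have a: "f (e x) \<in> W" using f(2) e(2)[OF x] by blast
    have b: "f' (x - e x) \<in> ?W'" using f'(2) in_W'[OF x] by blast
    show "f (e x) + f' (x - e x) \<in> V" using a b W(2) subspace_add[OF V] by blast
    show *: "e (f (e x) + f' (x - e x)) = f (e x)" using a b e(3) by (simp add: lin_add[OF e(1)])
    show "(f (e x) + f' (x - e x)) - e (f (e x) + f' (x - e x)) = f' (x - e x)" unfolding * by simp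
  qed
  note gp = glue[OF 1(1,3) 2(1,3)] and gq = glue[OF 1(2,4) 2(2,4)]
  define P where "P x = p (e x) + p' (x - e x)" for x
  define Q where "Q x = q (e x) + q' (x - e x)" for x
  have P: "lin P" "P x \<in> V" "e (P x) = p (e x)" "P x - e (P x) = p' (x - e x)" if "x \<in> V" for x
    using gp that unfolding P_def by blast+
  have Q: "lin Q" "Q x \<in> V" "e (Q x) = q (e x)" "Q x - e (Q x) = q' (x - e x)" if "x \<in> V" for x
    using gq that unfolding Q_def by blast+
  have *: "P (P x) = P x" "Q (Q x) = Q x" "T x = \<alpha> *s P x + \<beta> *s Q x" if x: "x \<in> V" for x
  proof -
    note 1 = 1(5)[OF e(2)[OF x]] and 2 = 2(5)[OF in_W'[OF x]]
    show "P (P x) = P x"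
      using 1 2 unfolding P_def[of "P x"] P(4)[OF x] P(3)[OF x] by (simp add: P_def)
    show "Q (Q x) = Q x"
      using 1 2 unfolding Q_def[of "Q x"] Q(4)[OF x] Q(3)[OF x] by (simp add: Q_def)
    have "T x = T (e x) + T (x - e x)" by (simp add: lin_simps[OF lin_T])
    also have "\<dots> = \<alpha> *s P x + \<beta> *s Q x"
      using 1 2 by (simp add: P_def Q_def scale_right_distrib add_ac)
    finally show "T x = \<alpha> *s P x + \<beta> *s Q x" .
  qed
  show ?thesis by (rule composite_onI[OF P(1) Q(1) P(2) Q(2) *]) (use subspace_0[OF V] in auto)
qed

text \<open>The three conditions are inherited by the complement \<open>W'\<close> of a maximal cyclic space \<open>W\<close>. A solution of the
homotopy equation is compressed to \<open>W'\<close>. Balance is subtracted, since \<open>W\<close>, being composite, is balanced.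
For intertwining, a block of \<open>V\<close> for \<open>a\<close> of size greater than \<open>k + 1\<close> forces \<open>W\<close> to have such a
block too, while \<open>W\<close> has at most one block for \<open>b\<close>; so removing \<open>W\<close> lowers the left-hand side by at least as much as the
right-hand side. Without such a block the left-hand side is 0.\<close>

theorem composite_on_if_invariants:
  assumes "invspace V" "homotopy V" "balanced V" "intertwined V"
  shows "composite_on V"
  using assms
proof (induction "dim V" arbitrary: V rule: less_induct)
  case less
  note V = less(2) and h = less(3) and bal = less(4) and it = less(5)
  have sV: "subspace V" and fV: "findim V" using invspaceD[OF V] by auto
  show ?case
  proof (cases "V = {0}")
    case True
    then show ?thesis by (intro composite_onI[OF lin_id lin_id]) (simp_all add: True)
  next
    case False
    obtain m v where mv: "v \<in> V" "is_order m v" "\<And>w. w \<in> V \<Longrightarrow> act m w = 0"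
      using maximal_order_exists[OF V] by metis
    let ?W = "cyclic v"
    have W: "invspace ?W" "?W \<subseteq> V" "subspace ?W"
      using invspace_cyclic[OF V mv(1)] invspaceD(2) by auto
    have cW: "composite_on ?W" by (rule maximal_cyclic_composite[OF V mv h bal it])
    obtain e where e: "lin e" "\<And>x. x \<in> V \<Longrightarrow> e x \<in> ?W"
      "\<And>w. w \<in> ?W \<Longrightarrow> e w = w" "\<And>x. x \<in> V \<Longrightarrow> e (T x) = T (e x)"
      using cyclic_projection[OF V mv] by metis
    let ?W' = "{x \<in> V. e x = 0}"
    have W'_sub: "subspace ?W'" by (rule subspace_kernel[OF e(1) sV])
    have e_act: "e (act f x) = act f (e x)" if "x \<in> V" for f x
      by (rule act_commute[OF V e(1) e(4) that])
    have W': "invspace ?W'"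
      unfolding invspace_def using findim_mono[OF fV W'_sub] invspaceD(3)[OF V] e(4) by auto
    have eV: "e x \<in> V" if "x \<in> V" for x using e(2)[OF that] W(2) by blast
    have in_W': "x - e x \<in> ?W'" if x: "x \<in> V" for x
    proof -
      have "e (x - e x) = 0" using e(3)[OF e(2)[OF x]] by (simp add: lin_diff[OF e(1)])
      moreover have "x - e x \<in> V" using subspace_diff[OF sV x eV[OF x]] .
      ultimately show ?thesis by simp
    qed
    have split: "dim X = dim (X \<inter> ?W) + dim {x \<in> X. e x = 0}"
      if "e ` X \<subseteq> X" "subspace X" "X \<subseteq> V" for X
      by (rule dim_split[OF fV e(1) that(1) _ e(3) that(2,3)]) (use that e(2) in blast)
    have Ker: "dim (Ker V f) = dim (Ker ?W f) + dim (Ker ?W' f)" for f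
    proof -
      have "e ` Ker V f \<subseteq> Ker V f" using eV e_act lin_zero[OF e(1)] by (auto simp: Ker_def simp flip: e_act)
      moreover have "Ker V f \<inter> ?W = Ker ?W f" using W(2) by (auto simp: Ker_def)
      moreover have "{x \<in> Ker V f. e x = 0} = Ker ?W' f" by (auto simp: Ker_def)
      ultimately show ?thesis using split[of "Ker V f"] subspace_Ker[OF sV] by (auto simp: Ker_def)
    qed
    have Eig: "dim (Eig V a k) = dim (Eig ?W a k) + dim (Eig ?W' a k)" for a k
    proof -
      have img: "e x = act ([:- a, 1:] ^ k) (e z)" if "x = act ([:- a, 1:] ^ k) z" "z \<in> V" for x z
        using e_act that by simp
      have "e ` Eig V a k \<subseteq> Eig V a k"
      proof
        fix y assume "y \<in> e ` Eig V a k"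
        then obtain x z where x: "y = e x" "x \<in> V" "T x = a *s x" "z \<in> V" "x = act ([:- a, 1:] ^ k) z"
          by (auto simp: Eig_def)
        have "T y = a *s y" using x(3) e(4)[OF x(2)] by (simp add: x(1) lin_scale[OF e(1)])
        then show "y \<in> Eig V a k"
          unfolding Eig_def using img[OF x(5,4)] eV[OF x(2)] eV[OF x(4)] x(1) by blast
      qed
      moreover have "Eig V a k \<inter> ?W = Eig ?W a k"
      proof
        show "Eig ?W a k \<subseteq> Eig V a k \<inter> ?W" using W(2) unfolding Eig_def by blast
        show "Eig V a k \<inter> ?W \<subseteq> Eig ?W a k"
        proof
          fix x assume "x \<in> Eig V a k \<inter> ?W"
          then obtain z where x: "x \<in> ?W" "T x = a *s x" "z \<in> V" "x = act ([:- a, 1:] ^ k) z"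
            by (auto simp: Eig_def)
          then have "x = act ([:- a, 1:] ^ k) (e z)" using img[OF x(4,3)] e(3) by simp
          then show "x \<in> Eig ?W a k" unfolding Eig_def using x(1,2) e(2)[OF x(3)] by blast
        qed
      qed
      moreover have "{x \<in> Eig V a k. e x = 0} = Eig ?W' a k"
      proof
        show "Eig ?W' a k \<subseteq> {x \<in> Eig V a k. e x = 0}" unfolding Eig_def by blast
        show "{x \<in> Eig V a k. e x = 0} \<subseteq> Eig ?W' a k"
        proof
          fix x assume "x \<in> {x \<in> Eig V a k. e x = 0}"
          then obtain z where x: "x \<in> V" "e x = 0" "T x = a *s x" "z \<in> V" "x = act ([:- a, 1:] ^ k) z"
            by (auto simp: Eig_def)
          then have "x = act ([:- a, 1:] ^ k) (z - e z)"
            using img[OF x(5,4)] by (simp add: act_lin_simps)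
          then show "x \<in> Eig ?W' a k" unfolding Eig_def using x(1-3) in_W'[OF x(4)] by blast
        qed
      qed
      ultimately show ?thesis
        using split[of "Eig V a k"] subspace_Eig[OF sV] by (auto simp: Eig_def)
    qed
    have "homotopy ?W'"
    proof -
      obtain F where F: "lin F" "F ` V \<subseteq> V"
        "\<And>x. x \<in> V \<Longrightarrow> T (F x) + F (T x) - (\<alpha> + \<beta>) *s F x = act tau x"
        using h unfolding homotopy_def by blast
      define F' where "F' x = F x - e (F x)" for x
      have "lin F'" unfolding F'_def by (intro lin_minus lin_comp[OF e(1) F(1)] F(1))
      moreover have "F' ` ?W' \<subseteq> ?W'" unfolding F'_def using in_W' F(2) by blast
      moreover have "T (F' x) + F' (T x) - (\<alpha> + \<beta>) *s F' x = act tau x" if x: "x \<in> ?W'" for x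
      proof -
        have xV: "x \<in> V" "e x = 0" using x by auto
        have FxV: "F x \<in> V" using F(2) xV(1) by blast
        have "e (act tau x) = 0" using e_act[OF xV(1)] xV(2) by (simp add: act_lin_simps)
        then have "T (e (F x)) + e (F (T x)) - (\<alpha> + \<beta>) *s e (F x) = 0"
          unfolding F(3)[OF xV(1), symmetric]
          by (simp add: lin_simps[OF e(1)] e(4)[OF FxV])
        then show ?thesis
          unfolding F(3)[OF xV(1), symmetric] F'_def
          by (simp add: lin_simps[OF lin_T] scale_right_diff_distrib algebra_simps)
      qed
      ultimately show ?thesis unfolding homotopy_def by blast
    qed
    moreover have "balanced ?W'"
      unfolding balanced_def
    proof (intro allI impI)
      fix f assume f: "coprime f tau"
      have "dim (Ker V f) = dim (Ker V (reflect f))" using bal f by (simp add: balanced_def)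
      moreover have "dim (Ker ?W f) = dim (Ker ?W (reflect f))"
        using composite_balanced[OF W(1) cW] f by (simp add: balanced_def)
      ultimately show "dim (Ker ?W' f) = dim (Ker ?W' (reflect f))" using Ker[of f] Ker[of "reflect f"] by linarith
    qed
    moreover have "intertwined ?W'"
      unfolding intertwined_def
    proof (intro allI impI)
      fix a b k assume ab: "a + b = \<alpha> + \<beta>" "poly tau a = 0" "a \<noteq> b"
      have le: "dim (Eig V a (Suc k)) \<le> dim (Eig V b k)" using it ab unfolding intertwined_def by blast
      show "dim (Eig ?W' a (Suc k)) \<le> dim (Eig ?W' b k)"
      proof (cases "dim (Eig V a (Suc k)) = 0")
        case True
        then show ?thesis using Eig[of a "Suc k"] by linarith
      next
        case False
        then obtain y where "y \<in> Eig V a (Suc k)" "y \<noteq> 0"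
          using dim_pos_iff[OF findim_Eig[OF V]] by blast
        then have "Suc k < order a m"
          using Eig_nonzero_order[OF _ mv(3)] mv(2) unfolding is_order_def by blast
        then obtain w where "w \<in> Eig ?W a (Suc k)" "w \<noteq> 0" using order_Eig_nonzero[OF mv(2)] by metis
        then have "dim (Eig ?W a (Suc k)) > 0" using dim_pos_iff[OF findim_Eig[OF W(1)]] by blast
        then show ?thesis
          using le Eig[of a "Suc k"] Eig[of b k] dim_Eig_cyclic[OF mv(2), of b k] by linarith
      qed
    qed
    moreover have "dim ?W' < dim V"
    proof -
      have "v \<noteq> 0"
      proof
        assume v0: "v = 0"
        have "act 1 v = 0" using v0 by simp
        then have "m dvd 1" using is_orderD[OF mv(2)] by blast
        then have "w = 0" if "w \<in> V" for w
        proof -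
          obtain k where "1 = m * k" using \<open>m dvd 1\<close> by (rule dvdE)
          then have "w = act k (act m w)" by (metis act_1 act_mult mult.commute)
          then show ?thesis using mv(3)[OF that] by (simp add: act_lin_simps)
        qed
        then show False using False subspace_0[OF sV] by blast
      qed
      moreover have "v \<in> ?W" using act_in_cyclic[of 1 v] by simp
      ultimately have "dim ?W > 0" using dim_pos_iff[OF invspaceD(1)[OF W(1)]] by blast
      moreover have "V \<inter> ?W = ?W" using W(2) by blast
      then have "dim V = dim ?W + dim ?W'" using split[of V] eV sV by auto
      ultimately show ?thesis by linarith
    qed
    ultimately have cW': "composite_on ?W'" using less(1)[OF _ W'] by blast
    show ?thesis by (rule composite_on_sum[OF sV W(3,2) e(1-3) cW cW'])
  qed
qed

end

section \<open>Matrices as operators on sequences\<close>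

definition fscale :: "'k::field \<Rightarrow> (nat \<Rightarrow> 'k) \<Rightarrow> nat \<Rightarrow> 'k" where
  "fscale c v = (\<lambda>i. c * v i)"

lemma fscale_apply [simp]: "fscale c v i = c * v i" by (simp add: fscale_def)

interpretation fs: vspace fscale
  by unfold_locales (simp_all add: fun_eq_iff algebra_simps)

lemma sum_fun_apply: "(\<Sum>b\<in>B. f b) i = (\<Sum>b\<in>B. f b i)" for f :: "'b \<Rightarrow> nat \<Rightarrow> 'k::field"
  by (induction B rule: infinite_finite_induct) simp_all

text \<open>\<open>K\<^sup>n\<close> inside the space of all sequences, so that the dimension need not be part of the type.\<close>

definition coord :: "nat \<Rightarrow> (nat \<Rightarrow> 'k::field) set" where
  "coord n = {v. \<forall>i\<ge>n. v i = 0}"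

definition unit_fun :: "nat \<Rightarrow> nat \<Rightarrow> 'k::field" where
  "unit_fun j = (\<lambda>i. if i = j then 1 else 0)"

lemma unit_fun_apply [simp]: "unit_fun j i = (if i = j then 1 else 0)"
  by (simp add: unit_fun_def)

lemma unit_fun_coord: "j < n \<Longrightarrow> unit_fun j \<in> coord n"
  by (simp add: coord_def)

lemma subspace_coord: "fs.subspace (coord n)"
  by (rule fs.subspaceI) (auto simp: coord_def)

lemma coord_expand:
  assumes "v \<in> coord n"
  shows "v = (\<Sum>j<n. fscale (v j) (unit_fun j))"
proof
  fix i
  have "(\<Sum>j<n. fscale (v j) (unit_fun j)) i = (\<Sum>j<n. if i = j then v j else 0)"
    unfolding sum_fun_apply by (intro sum.cong) auto
  then show "v i = (\<Sum>j<n. fscale (v j) (unit_fun j)) i"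
    using assms by (simp add: coord_def)
qed

lemma inj_unit_fun: "inj (unit_fun :: nat \<Rightarrow> nat \<Rightarrow> 'k::field)"
proof (rule injI)
  fix j k assume "unit_fun j = (unit_fun k :: nat \<Rightarrow> 'k)"
  then have "(unit_fun j j :: 'k) = unit_fun k j" by simp
  then show "j = k" by (simp split: if_splits)
qed

lemma
  shows findim_coord: "fs.findim (coord n :: (nat \<Rightarrow> 'k::field) set)"
    and dim_coord: "fs.dim (coord n :: (nat \<Rightarrow> 'k) set) = n"
proof -
  let ?B = "unit_fun ` {..<n} :: (nat \<Rightarrow> 'k) set"
  have inj: "inj_on (unit_fun :: nat \<Rightarrow> nat \<Rightarrow> 'k) {..<n}" using inj_unit_fun by (rule inj_on_subset) simp
  have span: "coord n \<subseteq> fs.span ?B"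
  proof
    fix v :: "nat \<Rightarrow> 'k" assume "v \<in> coord n"
    then have "v = (\<Sum>j<n. fscale (v j) (unit_fun j))" by (rule coord_expand)
    also have "\<dots> \<in> fs.span ?B"
      by (intro fs.span_sum fs.span_scale fs.span_base) auto
    finally show "v \<in> fs.span ?B" .
  qed
  then show "fs.findim (coord n :: (nat \<Rightarrow> 'k) set)"
    unfolding fs.findim_def using subspace_coord by blast
  have ind: "fs.independent ?B"
  proof
    assume "fs.dependent ?B"
    then obtain u where u: "\<exists>b\<in>?B. u b \<noteq> 0" "(\<Sum>b\<in>?B. fscale (u b) b) = 0"
      by (auto simp: fs.dependent_finite)
    have "u (unit_fun i) = 0" if "i < n" for i
    proof -
      have "0 = (\<Sum>j<n. fscale (u (unit_fun j)) (unit_fun j)) i"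
        using u(2) inj by (simp add: sum.reindex)
      also have "\<dots> = (\<Sum>j<n. if i = j then u (unit_fun j) else 0)"
        unfolding sum_fun_apply by (intro sum.cong) auto
      also have "\<dots> = u (unit_fun i)" using that by simp
      finally show ?thesis by simp
    qed
    then show False using u(1) by auto
  qed
  have "?B \<subseteq> coord n" using unit_fun_coord by auto
  then have "card ?B = fs.dim (coord n :: (nat \<Rightarrow> 'k) set)"
    by (rule fs.basis_card_eq_dim[OF _ span ind])
  then show "fs.dim (coord n :: (nat \<Rightarrow> 'k) set) = n" using inj by (simp add: card_image)
qed

definition mat_op :: "nat \<Rightarrow> 'k::field mat \<Rightarrow> (nat \<Rightarrow> 'k) \<Rightarrow> nat \<Rightarrow> 'k" where
  "mat_op n A v = (\<lambda>i. if i < n then \<Sum>j<n. A $$ (i, j) * v j else 0)"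

lemma mat_op_apply: "i < n \<Longrightarrow> mat_op n A v i = (\<Sum>j<n. A $$ (i, j) * v j)"
  by (simp add: mat_op_def)

lemma mat_op_coord: "mat_op n A v \<in> coord n"
  by (simp add: mat_op_def coord_def)

lemma coord_eqI: "v \<in> coord n \<Longrightarrow> w \<in> coord n \<Longrightarrow> (\<And>i. i < n \<Longrightarrow> v i = w i) \<Longrightarrow> v = w"
  by (rule ext) (metis (mono_tags, lifting) coord_def leI mem_Collect_eq)

lemma lin_mat_op: "fs.lin (mat_op n A)"
  by (rule fs.linI)
    (auto simp: mat_op_def fun_eq_iff distrib_left sum.distrib sum_distrib_left mult.left_commute
      intro!: sum.cong)

lemma mat_op_mult:
  assumes "A \<in> carrier_mat n n" "B \<in> carrier_mat n n"
  shows "mat_op n (A * B) v = mat_op n A (mat_op n B v)"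
proof (rule coord_eqI[OF mat_op_coord mat_op_coord])
  fix i assume i: "i < n"
  have "mat_op n (A * B) v i = (\<Sum>j<n. (\<Sum>k<n. A $$ (i, k) * B $$ (k, j)) * v j)"
    unfolding mat_op_apply[OF i] using assms i
    by (intro sum.cong refl) (simp add: scalar_prod_def atLeast0LessThan)
  also have "\<dots> = (\<Sum>j<n. \<Sum>k<n. A $$ (i, k) * B $$ (k, j) * v j)"
    by (simp only: sum_distrib_right)
  also have "\<dots> = (\<Sum>k<n. \<Sum>j<n. A $$ (i, k) * B $$ (k, j) * v j)" by (rule sum.swap)
  also have "\<dots> = (\<Sum>k<n. A $$ (i, k) * mat_op n B v k)"
    by (intro sum.cong refl) (simp add: mat_op_apply sum_distrib_left mult.assoc)
  finally show "mat_op n (A * B) v i = mat_op n A (mat_op n B v) i" by (simp add: mat_op_apply[OF i])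
qed

lemma mat_op_lincomb:
  assumes "P \<in> carrier_mat n n" "Q \<in> carrier_mat n n"
  shows "mat_op n (a \<cdot>\<^sub>m P + b \<cdot>\<^sub>m Q) v = fscale a (mat_op n P v) + fscale b (mat_op n Q v)"
  by (rule ext) (use assms in \<open>auto simp: mat_op_def sum_distrib_left algebra_simps simp flip: sum.distrib
      intro!: sum.cong\<close>)

lemma mat_op_unit: "i < n \<Longrightarrow> j < n \<Longrightarrow> mat_op n A (unit_fun j) i = A $$ (i, j)"
  by (simp add: mat_op_apply if_distrib[of "(*) _"] cong: if_cong)

lemma mat_op_inj:
  assumes "A \<in> carrier_mat n n" "B \<in> carrier_mat n n"
    and eq: "\<And>v. v \<in> coord n \<Longrightarrow> mat_op n A v = mat_op n B v"
  shows "A = B"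
proof (rule eq_matI)
  fix i j assume "i < dim_row B" "j < dim_col B"
  then have ij: "i < n" "j < n" using assms by auto
  show "A $$ (i, j) = B $$ (i, j)"
    using eq[OF unit_fun_coord[OF ij(2)]] mat_op_unit[OF ij, of A] mat_op_unit[OF ij, of B] by simp
qed (use assms in auto)

lemma mat_of_lin:
  assumes p: "fs.lin p" and pV: "p ` coord n \<subseteq> coord n"
  obtains P where "P \<in> carrier_mat n n" "\<And>v. v \<in> coord n \<Longrightarrow> mat_op n P v = p v"
proof -
  define P where "P = mat n n (\<lambda>(i, j). p (unit_fun j) i)"
  interpret pr: vector_space_pair fscale fscale by unfold_locales
  have "mat_op n P v = p v" if v: "v \<in> coord n" for v
  proof (rule coord_eqI[OF mat_op_coord])
    show "p v \<in> coord n" using pV v by blast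
    fix i assume i: "i < n"
    have "p v = p (\<Sum>j<n. fscale (v j) (unit_fun j))" using coord_expand[OF v] by simp
    also have "\<dots> = (\<Sum>j<n. fscale (v j) (p (unit_fun j)))"
      by (simp add: pr.linear_sum[OF p] pr.linear_scale[OF p])
    finally have "p v i = (\<Sum>j<n. v j * p (unit_fun j) i)" by (simp add: sum_fun_apply)
    then show "mat_op n P v i = p v i"
      unfolding mat_op_apply[OF i] using i by (simp add: P_def mult.commute)
  qed
  then show ?thesis using that[of P] by (simp add: P_def)
qed

lemma invspace_coord:
  assumes "endo fscale T" "\<And>v. T v \<in> coord n"
  shows "endo.invspace fscale T (coord n)"
proof -
  interpret endo fscale T by fact
  show ?thesis unfolding invspace_def using findim_coord assms(2) by blast
qed

lemma endo_mat_op: "endo fscale (mat_op n A)"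
  by (intro endo.intro endo_axioms.intro lin_mat_op fs.vspace_axioms)

lemma composite_iff_composite_on:
  assumes A: "A \<in> carrier_mat n n" and nz: "\<alpha> \<noteq> 0" "\<beta> \<noteq> 0"
  shows "composite (module_mat TYPE('k::field) n n) \<alpha> \<beta> A \<longleftrightarrow>
    endo_pair.composite_on fscale (mat_op n A) \<alpha> \<beta> (coord n)"
proof -
  interpret endo_pair fscale "mat_op n A" \<alpha> \<beta>
    by (intro endo_pair.intro endo_mat_op) (unfold_locales, use nz in auto)
  have comp: "composite (module_mat TYPE('k) n n) \<alpha> \<beta> A \<longleftrightarrow>
    (\<exists>P\<in>carrier_mat n n. \<exists>Q\<in>carrier_mat n n. P * P = P \<and> Q * Q = Q \<and> A = \<alpha> \<cdot>\<^sub>m P + \<beta> \<cdot>\<^sub>m Q)"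
    using A by (simp add: composite_def module_mat_def)
  show ?thesis unfolding comp
  proof
    assume "\<exists>P\<in>carrier_mat n n. \<exists>Q\<in>carrier_mat n n. P * P = P \<and> Q * Q = Q \<and> A = \<alpha> \<cdot>\<^sub>m P + \<beta> \<cdot>\<^sub>m Q"
    then obtain P Q where PQ: "P \<in> carrier_mat n n" "Q \<in> carrier_mat n n" "P * P = P" "Q * Q = Q"
      "A = \<alpha> \<cdot>\<^sub>m P + \<beta> \<cdot>\<^sub>m Q" by blast
    show "composite_on (coord n)"
    proof (rule composite_onI[OF lin_mat_op lin_mat_op mat_op_coord mat_op_coord])
      show "mat_op n P (mat_op n P x) = mat_op n P x" for x
        using mat_op_mult[OF PQ(1,1), of x] PQ(3) by simp
      show "mat_op n Q (mat_op n Q x) = mat_op n Q x" for x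
        using mat_op_mult[OF PQ(2,2), of x] PQ(4) by simp
      show "mat_op n A x = fscale \<alpha> (mat_op n P x) + fscale \<beta> (mat_op n Q x)" for x
        unfolding PQ(5) by (rule mat_op_lincomb[OF PQ(1,2)])
    qed
  next
    assume "composite_on (coord n)"
    then obtain p q where pq: "fs.lin p" "fs.lin q" "p ` coord n \<subseteq> coord n" "q ` coord n \<subseteq> coord n"
      "\<And>x. x \<in> coord n \<Longrightarrow> p (p x) = p x \<and> q (q x) = q x \<and> mat_op n A x = fscale \<alpha> (p x) + fscale \<beta> (q x)"
      unfolding composite_on_def by blast
    obtain P where P: "P \<in> carrier_mat n n" "\<And>v. v \<in> coord n \<Longrightarrow> mat_op n P v = p v"
      using mat_of_lin[OF pq(1,3)] by blast
    obtain Q where Q: "Q \<in> carrier_mat n n" "\<And>v. v \<in> coord n \<Longrightarrow> mat_op n Q v = q v"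
      using mat_of_lin[OF pq(2,4)] by blast
    have in_V: "p v \<in> coord n" "q v \<in> coord n" if "v \<in> coord n" for v using pq(3,4) that by auto
    have "P * P = P"
      by (rule mat_op_inj) (use P pq(5) in_V in \<open>auto simp: mat_op_mult\<close>)
    moreover have "Q * Q = Q"
      by (rule mat_op_inj) (use Q pq(5) in_V in \<open>auto simp: mat_op_mult\<close>)
    moreover have "A = \<alpha> \<cdot>\<^sub>m P + \<beta> \<cdot>\<^sub>m Q"
    proof (rule mat_op_inj)
      show "mat_op n A v = mat_op n (\<alpha> \<cdot>\<^sub>m P + \<beta> \<cdot>\<^sub>m Q) v" if "v \<in> coord n" for v
        using pq(5)[OF that] P(2)[OF that] Q(2)[OF that] by (simp add: mat_op_lincomb[OF P(1) Q(1)])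
    qed (use A P Q in auto)
    ultimately show "\<exists>P\<in>carrier_mat n n. \<exists>Q\<in>carrier_mat n n. P * P = P \<and> Q * Q = Q \<and>
      A = \<alpha> \<cdot>\<^sub>m P + \<beta> \<cdot>\<^sub>m Q" using P(1) Q(1) by blast
  qed
qed

section \<open>Field extensions\<close>

locale base_change = field_hom h for h :: "'k::field \<Rightarrow> 'l::field"
begin

lemma h_nonzero: "x \<noteq> 0 \<Longrightarrow> h x \<noteq> 0"
  by (metis hom_mult hom_one mult_zero_left right_inverse zero_neq_one)

lemma h_inj: "h x = h y \<longleftrightarrow> x = y"
  using h_nonzero[of "x - y"] by (auto simp: hom_minus)

definition emb :: "(nat \<Rightarrow> 'k) \<Rightarrow> nat \<Rightarrow> 'l" where "emb v = (\<lambda>i. h (v i))"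

lemma emb_apply [simp]: "emb v i = h (v i)" by (simp add: emb_def)

lemma inj_emb: "inj emb"
  by (rule injI) (simp add: fun_eq_iff h_inj)

definition functional :: "('l \<Rightarrow> 'k) \<Rightarrow> bool" where
  "functional \<phi> \<longleftrightarrow> (\<forall>x y. \<phi> (x + y) = \<phi> x + \<phi> y) \<and> (\<forall>c x. \<phi> (h c * x) = c * \<phi> x)"

text \<open>\<open>K\<close>-linear functionals on the extension field separate points, because any nonzero element is part of
a basis over \<open>K\<close>.\<close>

lemma functional_exists:
  assumes "l0 \<noteq> 0"
  obtains \<phi> where "functional \<phi>" "\<phi> l0 = 1"
proof -
  interpret L: vector_space "\<lambda>c l. h c * l"
    by unfold_locales (simp_all add: hom_add hom_mult algebra_simps)
  interpret K: vector_space "(*) :: 'k \<Rightarrow> 'k \<Rightarrow> 'k"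
    by unfold_locales (simp_all add: algebra_simps)
  interpret P: vector_space_pair "\<lambda>c l. h c * l" "(*) :: 'k \<Rightarrow> 'k \<Rightarrow> 'k" by unfold_locales
  have "L.independent {l0}" using assms by simp
  then obtain \<phi> where "\<phi> l0 = 1" and lin: "Vector_Spaces.linear (\<lambda>c l. h c * l) (*) \<phi>"
    using P.linear_independent_extend[of "{l0}" "\<lambda>_. 1"] by auto
  moreover have "functional \<phi>"
    unfolding functional_def using P.linear_add[OF lin] P.linear_scale[OF lin] by blast
  ultimately show ?thesis using that by blast
qed

lemma functional_zero: "functional \<phi> \<Longrightarrow> \<phi> 0 = 0"
proof -
  assume "functional \<phi>"
  then have "\<phi> (h 0 * 0) = 0 * \<phi> 0" unfolding functional_def by blast
  then show ?thesis by simp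
qed

lemma functional_simps:
  assumes "functional \<phi>"
  shows "\<phi> (x + y) = \<phi> x + \<phi> y" "\<phi> (h c * x) = c * \<phi> x" "\<phi> 0 = 0" "\<phi> (x - y) = \<phi> x - \<phi> y"
    "\<phi> (\<Sum>b\<in>B. f b) = (\<Sum>b\<in>B. \<phi> (f b))"
proof -
  show add: "\<phi> (x + y) = \<phi> x + \<phi> y" for x y using assms by (simp add: functional_def)
  show "\<phi> (h c * x) = c * \<phi> x" using assms by (simp add: functional_def)
  show zero: "\<phi> 0 = 0" 
    using functional_zero[OF assms] .
  show "\<phi> (x - y) = \<phi> x - \<phi> y" using add[of "x - y" y] by simp
  show "\<phi> (\<Sum>b\<in>B. f b) = (\<Sum>b\<in>B. \<phi> (f b))"
    by (induction B rule: infinite_finite_induct) (simp_all add: zero add)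
qed

text \<open>Applying a functional \<open>L \<rightarrow> K\<close> to the coefficients of a relation over \<open>L\<close> gives a relation over \<open>K\<close>; the
functional is chosen so that one coefficient survives.\<close>

lemma emb_independent:
  assumes B: "finite B" "fs.independent B"
  shows "fs.independent (emb ` B)"
proof
  assume "fs.dependent (emb ` B)"
  then obtain u where u: "\<exists>b\<in>emb ` B. u b \<noteq> 0" "(\<Sum>b\<in>emb ` B. fscale (u b) b) = 0"
    using B(1) by (auto simp: fs.dependent_finite)
  then obtain b0 where b0: "b0 \<in> B" "u (emb b0) \<noteq> 0" by auto
  obtain \<phi> where \<phi>: "functional \<phi>" "\<phi> (u (emb b0)) = 1" using functional_exists[OF b0(2)] .
  have inj: "inj_on emb B" using inj_emb by (rule inj_on_subset) simp
  have "(\<Sum>b\<in>B. fscale (\<phi> (u (emb b))) b) = 0"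
  proof
    fix i
    have "0 = \<phi> ((\<Sum>b\<in>B. fscale (u (emb b)) (emb b)) i)"
      using u(2) inj by (simp add: sum.reindex functional_simps[OF \<phi>(1)])
    also have "\<dots> = (\<Sum>b\<in>B. \<phi> (h (b i) * u (emb b)))"
      by (simp add: sum_fun_apply functional_simps(5)[OF \<phi>(1)] mult.commute)
    also have "\<dots> = (\<Sum>b\<in>B. fscale (\<phi> (u (emb b))) b) i"
      by (simp add: sum_fun_apply functional_simps(2)[OF \<phi>(1)] mult.commute)
    finally show "(\<Sum>b\<in>B. fscale (\<phi> (u (emb b))) b) i = 0 i" by simp
  qed
  moreover have "\<phi> (u (emb b0)) \<noteq> 0" using \<phi>(2) by simp
  ultimately have "fs.dependent B"
    using B(1) b0(1) unfolding fs.dependent_finite[OF B(1)]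
    by (intro exI[of _ "\<lambda>b. \<phi> (u (emb b))"]) blast
  then show False using B(2) by simp
qed

lemma dim_emb_le:
  assumes X: "fs.findim X" and Y: "fs.findim Y" and sub: "emb ` X \<subseteq> Y"
  shows "fs.dim X \<le> fs.dim Y"
proof -
  obtain B where B: "B \<subseteq> X" "fs.independent B" "finite B" "card B = fs.dim X"
    using fs.findim_basis_extend[OF X fs.independent_empty] by auto
  have "card (emb ` B) \<le> fs.dim Y"
    using fs.findim_independent(2)[OF Y emb_independent[OF B(3,2)]] sub B(1) by blast
  moreover have "card (emb ` B) = card B"
    by (rule card_image) (rule inj_on_subset[OF inj_emb], simp)
  ultimately show ?thesis using B(4) by simp
qed

abbreviation hp :: "'k poly \<Rightarrow> 'l poly" where "hp \<equiv> map_poly h"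

lemma hp_pCons: "hp (pCons a f) = pCons (h a) (hp f)"
  by (simp add: map_poly_pCons)

lemma hp_add: "hp (f + g) = hp f + hp g"
  by (rule poly_eqI) (simp add: coeff_map_poly hom_add)

lemma hp_smult: "hp (smult c f) = smult (h c) (hp f)"
  by (rule poly_eqI) (simp add: coeff_map_poly hom_mult)

lemma hp_mult: "hp (f * g) = hp f * hp g"
  by (induction f) (simp_all add: hp_pCons hp_add hp_smult)

lemma hp_1: "hp 1 = 1"
  by (simp add: one_pCons hp_pCons)

lemma hp_power: "hp (f ^ k) = hp f ^ k"
  by (induction k) (simp_all add: hp_mult hp_1)

lemma hp_pcompose: "hp (pcompose f g) = pcompose (hp f) (hp g)"
  by (induction f) (simp_all add: pcompose_pCons hp_pCons hp_add hp_mult)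

lemma poly_hp: "poly (hp f) (h a) = h (poly f a)"
  by (induction f) (simp_all add: hp_pCons hom_add hom_mult)

end

locale mat_base_change = base_change h
  for h :: "'k::field \<Rightarrow> 'l::field" +
  fixes A :: "'k mat" and n :: nat and \<alpha> \<beta> :: 'k
  assumes A: "A \<in> carrier_mat n n" and nz: "\<alpha> \<noteq> 0" "\<beta> \<noteq> 0"
begin

sublocale K: endo_pair fscale "mat_op n A" \<alpha> \<beta>
  by (intro endo_pair.intro endo_mat_op) (unfold_locales, use nz in auto)

sublocale L: endo_pair fscale "mat_op n (map_mat h A)" "h \<alpha>" "h \<beta>"
  by (intro endo_pair.intro endo_mat_op) (unfold_locales, use nz h_nonzero in auto)

lemma inv_K: "K.invspace (coord n)" and inv_L: "L.invspace (coord n)"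
  by (rule invspace_coord[OF endo_mat_op mat_op_coord])+

lemma emb_mat_op: "emb (mat_op n A v) = mat_op n (map_mat h A) (emb v)"
  using A by (auto simp: fun_eq_iff mat_op_def hom_sum hom_mult intro!: sum.cong)

lemma emb_act: "emb (K.act f v) = L.act (hp f) (emb v)"
proof (induction f)
  case 0
  have "emb 0 = 0" by (simp add: fun_eq_iff)
  then show ?case by (simp only: map_poly_0 K.act_0 L.act_0)
next
  case (pCons a f)
  have "emb (K.act (pCons a f) v) = fscale (h a) (emb v) + emb (mat_op n A (K.act f v))"
    by (simp add: fun_eq_iff hom_add hom_mult)
  also have "\<dots> = L.act (hp (pCons a f)) (emb v)"
    unfolding emb_mat_op pCons(2) hp_pCons L.act_pCons ..
  finally show ?case .
qed

text \<open>Embedding a basis shows that neither the kernel nor the image of \<open>f(A)\<close> can become smaller over the larger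
field, and by the rank formula both dimensions add up to \<open>n\<close> over either field.\<close>

lemma dim_Ker: "fs.dim (K.Ker (coord n) f) = fs.dim (L.Ker (coord n) (hp f))"
proof -
  let ?VK = "coord n :: (nat \<Rightarrow> 'k) set" and ?VL = "coord n :: (nat \<Rightarrow> 'l) set"
  have emb_coord: "emb v \<in> coord n" if "v \<in> coord n" for v using that by (auto simp: coord_def)
  have "fs.dim (K.Ker ?VK f) \<le> fs.dim (L.Ker ?VL (hp f))"
  proof (rule dim_emb_le[OF K.findim_Ker[OF inv_K] L.findim_Ker[OF inv_L]])
    show "emb ` K.Ker ?VK f \<subseteq> L.Ker ?VL (hp f)"
    proof
      fix y assume "y \<in> emb ` K.Ker ?VK f"
      then obtain x where x: "x \<in> coord n" "K.act f x = 0" "y = emb x" by (auto simp: K.Ker_def)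
      have "L.act (hp f) (emb x) = 0" unfolding emb_act[symmetric] x(2) by (simp add: fun_eq_iff)
      then show "y \<in> L.Ker ?VL (hp f)" using emb_coord[OF x(1)] x(3) by (simp add: L.Ker_def)
    qed
  qed
  moreover have "fs.dim (K.act f ` ?VK) \<le> fs.dim (L.act (hp f) ` ?VL)"
  proof (rule dim_emb_le[OF fs.findim_image[OF K.lin_act findim_coord] fs.findim_image[OF L.lin_act findim_coord]])
    show "emb ` K.act f ` ?VK \<subseteq> L.act (hp f) ` ?VL"
      using emb_coord by (auto simp: emb_act)
  qed
  moreover have "n = fs.dim (K.Ker ?VK f) + fs.dim (K.act f ` ?VK)"
    using fs.rank_nullity[OF K.lin_act[of f] findim_coord[of n]] by (simp add: dim_coord K.Ker_def)
  moreover have "n = fs.dim (L.Ker ?VL (hp f)) + fs.dim (L.act (hp f) ` ?VL)"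
    using fs.rank_nullity[OF L.lin_act[of "hp f"] findim_coord[of n]] by (simp add: dim_coord L.Ker_def)
  ultimately show ?thesis by linarith
qed

lemma dim_Eig: "fs.dim (K.Eig (coord n) a k) = fs.dim (L.Eig (coord n) (h a) k)"
proof -
  have *: "hp ([:- a, 1:] ^ j) = [:- h a, 1:] ^ j" for j by (simp add: hp_power hp_pCons hom_uminus)
  show ?thesis
    using K.dim_Ker_power[OF inv_K, of a k, unfolded dim_Ker *] L.dim_Ker_power[OF inv_L, of "h a" k]
    by linarith
qed

lemma hp_tau: "hp K.tau = L.tau"
proof -
  have "hp K.quad = L.quad"
    by (simp add: K.quad_def L.quad_def hp_pCons hom_add hom_uminus hom_minus)
  moreover have "hp [:\<alpha> * \<beta>:] = [:h \<alpha> * h \<beta>:]" by (simp add: hp_pCons hom_mult)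
  ultimately show ?thesis by (simp only: K.tau_def L.tau_def hp_mult hp_add)
qed

lemma hp_reflect: "hp (K.reflect f) = L.reflect (hp f)"
  by (simp add: K.reflect_def L.reflect_def hp_pcompose hp_pCons hom_add hom_uminus)

lemma balanced_descent:
  assumes "L.balanced (coord n)"
  shows "K.balanced (coord n)"
  unfolding K.balanced_def
proof (intro allI impI)
  fix f assume "coprime f K.tau"
  then obtain u w where "u * f + w * K.tau = 1" using coprime_poly_bezout by metis
  then have "hp (u * f + w * K.tau) = 1" by (simp only: hp_1)
  then have "hp u * hp f + hp w * L.tau = 1" by (simp only: hp_add hp_mult hp_tau)
  then have "coprime (hp f) L.tau" by (rule coprime_polyI)
  then show "fs.dim (K.Ker (coord n) f) = fs.dim (K.Ker (coord n) (K.reflect f))"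
    using assms unfolding L.balanced_def dim_Ker hp_reflect by blast
qed

lemma intertwined_descent:
  assumes "L.intertwined (coord n)"
  shows "K.intertwined (coord n)"
  unfolding K.intertwined_def
proof (intro allI impI)
  fix a b k assume ab: "a + b = \<alpha> + \<beta>" "poly K.tau a = 0" "a \<noteq> b"
  have "h a + h b = h \<alpha> + h \<beta>" using ab(1) by (metis hom_add)
  moreover have "poly L.tau (h a) = 0" using ab(2) by (simp add: poly_hp flip: hp_tau)
  moreover have "h a \<noteq> h b" using ab(3) by (simp add: h_inj)
  ultimately show "fs.dim (K.Eig (coord n) a (Suc k)) \<le> fs.dim (K.Eig (coord n) b k)"
    using assms unfolding L.intertwined_def dim_Eig by blast
qed

text \<open>A solution over \<open>L\<close> is restricted to \<open>K\<^sup>n\<close> and then mapped back to \<open>K\<^sup>n\<close> by a \<open>K\<close>-linear retraction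
\<open>L \<rightarrow> K\<close> applied to each coordinate; this commutes with matrices over \<open>K\<close>.\<close>

lemma homotopy_descent:
  assumes "L.homotopy (coord n)"
  shows "K.homotopy (coord n)"
proof -
  obtain F where F: "fs.lin F" "F ` coord n \<subseteq> coord n"
    "\<And>x. x \<in> coord n \<Longrightarrow> mat_op n (map_mat h A) (F x) + F (mat_op n (map_mat h A) x)
      - fscale (h \<alpha> + h \<beta>) (F x) = L.act L.tau x"
    using assms unfolding L.homotopy_def by blast
  obtain \<phi> where \<phi>: "functional \<phi>" "\<phi> 1 = 1" using functional_exists[OF one_neq_zero] .
  note phi = functional_simps[OF \<phi>(1)]
  define res where "res w = (\<lambda>i. \<phi> (w i))" for w :: "nat \<Rightarrow> 'l"
  have res_add: "res (v + w) = res v + res w" for v w by (simp add: res_def fun_eq_iff phi)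
  have res_diff: "res (v - w) = res v - res w" for v w by (simp add: res_def fun_eq_iff phi)
  have res_scale: "res (fscale (h c) v) = fscale c (res v)" for c v by (simp add: res_def fun_eq_iff phi)
  have res_emb: "res (emb v) = v" for v
    using phi(2)[of _ 1] \<phi>(2) by (simp add: res_def fun_eq_iff)
  have res_mat: "res (mat_op n (map_mat h A) v) = mat_op n A (res v)" for v
    using A by (auto simp: res_def fun_eq_iff mat_op_def phi intro!: sum.cong)
  have emb_add: "emb (v + w) = emb v + emb w" for v w by (simp add: fun_eq_iff hom_add)
  have emb_scale: "emb (fscale c v) = fscale (h c) (emb v)" for c v by (simp add: fun_eq_iff hom_mult)
  define G where "G v = res (F (emb v))" for v
  have "fs.lin G"
    by (rule fs.linI)
      (simp_all add: G_def emb_add emb_scale res_add res_scale fs.lin_add[OF F(1)] fs.lin_scale[OF F(1)])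
  moreover have "G v \<in> coord n" if "v \<in> coord n" for v
  proof -
    have "emb v \<in> coord n" using that by (simp add: coord_def)
    then have "F (emb v) \<in> coord n" using F(2) by blast
    then show ?thesis by (simp add: G_def res_def coord_def phi)
  qed
  moreover have "mat_op n A (G v) + G (mat_op n A v) - fscale (\<alpha> + \<beta>) (G v) = K.act K.tau v"
    if "v \<in> coord n" for v
  proof -
    have ev: "emb v \<in> coord n" using that by (simp add: coord_def)
    have "K.act K.tau v = res (L.act L.tau (emb v))"
      using res_emb[of "K.act K.tau v"] unfolding emb_act hp_tau by simp
    also have "\<dots> = mat_op n A (G v) + G (mat_op n A v) - fscale (\<alpha> + \<beta>) (G v)"
      unfolding F(3)[OF ev, symmetric] hom_add[symmetric] res_diff res_add res_scale res_mat
        emb_mat_op[symmetric] G_def ..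
    finally show ?thesis by simp
  qed
  ultimately show ?thesis unfolding K.homotopy_def by blast
qed

lemma composite_on_descent:
  assumes "L.composite_on (coord n)"
  shows "K.composite_on (coord n)"
  using K.composite_on_if_invariants[OF inv_K] homotopy_descent balanced_descent intertwined_descent
    L.composite_homotopy[OF inv_L assms] L.composite_balanced[OF inv_L assms]
    L.composite_intertwined[OF inv_L assms] by blast

lemma composite_map_mat:
  assumes "composite (module_mat TYPE('k) n n) \<alpha> \<beta> A"
  shows "composite (module_mat TYPE('l) n n) (h \<alpha>) (h \<beta>) (map_mat h A)"
proof -
  obtain P Q where PQ: "P \<in> carrier_mat n n" "Q \<in> carrier_mat n n" "P * P = P" "Q * Q = Q"
    "A = \<alpha> \<cdot>\<^sub>m P + \<beta> \<cdot>\<^sub>m Q"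
    using assms by (auto simp: composite_def module_mat_def)
  have "map_mat h P * map_mat h P = map_mat h P" "map_mat h Q * map_mat h Q = map_mat h Q"
    using mat_hom_mult[OF PQ(1,1)] mat_hom_mult[OF PQ(2,2)] PQ(3,4) by simp_all
  moreover have "map_mat h A = h \<alpha> \<cdot>\<^sub>m map_mat h P + h \<beta> \<cdot>\<^sub>m map_mat h Q"
    using PQ(1,2) unfolding PQ(5) by (intro eq_matI) (auto simp: hom_add hom_mult)
  ultimately show ?thesis
    unfolding composite_def
    by (intro conjI bexI[of _ "map_mat h P"] bexI[of _ "map_mat h Q"])
      (use A PQ(1,2) in \<open>simp_all add: module_mat_def\<close>)
qed

end

theorem mainTheorem9:
  fixes A :: "'k::field mat" and \<alpha> \<beta> :: 'k and n :: nat
    and h :: "'k \<Rightarrow> 'l::field"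
  assumes "n \<ge> 1"
    and "A \<in> carrier_mat n n"
    and "field_hom h"
    and "\<alpha> \<noteq> 0" and "\<beta> \<noteq> 0"
  shows "composite (module_mat TYPE('k) n n) \<alpha> \<beta> A \<longleftrightarrow>
         composite (module_mat TYPE('l) n n) (h \<alpha>) (h \<beta>) (map_mat h A)"
proof -
  interpret field_hom h by fact
  interpret mat_base_change h A n \<alpha> \<beta> by unfold_locales (use assms in auto)
  show ?thesis
  proof
    assume "composite (module_mat TYPE('k) n n) \<alpha> \<beta> A"
    then show "composite (module_mat TYPE('l) n n) (h \<alpha>) (h \<beta>) (map_mat h A)" by (rule composite_map_mat)
  next
    assume "composite (module_mat TYPE('l) n n) (h \<alpha>) (h \<beta>) (map_mat h A)"
    then have "L.composite_on (coord n)"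
      using composite_iff_composite_on[of "map_mat h A" n "h \<alpha>" "h \<beta>"] assms(2) nz h_nonzero by simp
    then have "K.composite_on (coord n)" by (rule composite_on_descent)
    then show "composite (module_mat TYPE('k) n n) \<alpha> \<beta> A"
      using composite_iff_composite_on[OF assms(2) nz] by simp
  qed
qed

end
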